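(* Let $\sigma>0$, $k>0$, and let $X_0\sim P=\mathcal N(0,\sigma^2)$ and $N\sim\mathcal N(0,1)$ be independent. Let $J^\star$ be the optimal value of the Witsenhausen problem, i.e. the infimum over all pairs of measurable functions $\gamma_1,\gamma_2:\mathbb R\to\mathbb R$ of $$J(\gamma_1,\gamma_2)=k^2\,\mathbb E[U_1^2]+\mathbb E[(Y-U_2)^2],\qquad U_1=\gamma_1(X_0),\ Y=X_0+U_1,\ U_2=\gamma_2(Y+N).$$ Then $$J^\star=\inf_{Q\in\mathcal P_2(\mathbb R)}\bigl\{k^2W_2^2(P,Q)+\operatorname{mmse}(Q)\bigr\}.$$ The infimum on the right is attained, and any minimizer $Q^\star$ is realized by a deterministic first controller, namely the monotone rearrangement $f^\star(x)=F_{Q^\star}^{-1}(F_P(x))$, with $Y=f^\star(X_0)$ (that is, $\gamma_1(x)=f^\star(x)-x$), which is the optimal transport map pushing $P$ to $Q^\star$ for the quadratic cost.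
   Context: $\mathcal P_2(\mathbb R)$ is the set of Borel probability measures on $\mathbb R$ with finite second moment. $F_\mu$ is the cumulative distribution function of $\mu$ and $F_\mu^{-1}$ its quantile function (generalized inverse). $W_2^2(P,Q)=\inf_{\pi}\int (x-y)^2\,\pi(dx,dy)$ over couplings $\pi$ of $P$ and $Q$. For $Q\in\mathcal P_2(\mathbb R)$, $\operatorname{mmse}(Q)=\mathbb E[\operatorname{Var}(Y\mid Y+N)]$ where $Y\sim Q$ and $N\sim\mathcal N(0,1)$ are independent. *)

theory Defs
  imports "HOL-Probability.Probability"
begin

definition gaussian :: "real \<Rightarrow> real \<Rightarrow> real measure" where
  "gaussian \<mu> \<sigma> = density lborel (normal_density \<mu> \<sigma>)"

definition P2 :: "real measure set" where
  "P2 = {Q. sets Q = sets borel \<and> prob_space Q \<and> integrable Q (\<lambda>x. x\<^sup>2)}"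

definition couplings :: "real measure \<Rightarrow> real measure \<Rightarrow> (real \<times> real) measure set" where
  "couplings P Q = {\<pi>. sets \<pi> = sets (borel \<Otimes>\<^sub>M borel) \<and> prob_space \<pi>
     \<and> distr \<pi> borel fst = P \<and> distr \<pi> borel snd = Q}"

definition W2_sq :: "real measure \<Rightarrow> real measure \<Rightarrow> ennreal" where
  "W2_sq P Q = (INF \<pi>\<in>couplings P Q. \<integral>\<^sup>+ z. ennreal ((fst z - snd z)\<^sup>2) \<partial>\<pi>)"

definition quantile :: "real measure \<Rightarrow> real \<Rightarrow> real" where
  "quantile Q u = Inf {y. u \<le> cdf Q y}"

definition monotone_rearrangement :: "real measure \<Rightarrow> real measure \<Rightarrow> real \<Rightarrow> real" where
  "monotone_rearrangement P Q x = quantile Q (cdf P x)"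

text \<open>Optimality of a map is measured against all couplings, not only against those induced by maps.\<close>

definition optimal_transport_map :: "real measure \<Rightarrow> real measure \<Rightarrow> (real \<Rightarrow> real) \<Rightarrow> bool" where
  "optimal_transport_map P Q T \<longleftrightarrow>
     T \<in> borel_measurable borel \<and> distr P borel T = Q
     \<and> (\<integral>\<^sup>+ x. ennreal ((x - T x)\<^sup>2) \<partial>P) = W2_sq P Q"

definition cond_var :: "'a measure \<Rightarrow> 'a measure \<Rightarrow> ('a \<Rightarrow> real) \<Rightarrow> 'a \<Rightarrow> real" where
  "cond_var M F X = real_cond_exp M F (\<lambda>\<omega>. (X \<omega> - real_cond_exp M F X \<omega>)\<^sup>2)"

text \<open>The value depends only on the joint law of the independent pair $(Y,N)$, so it is computed
  on the product space, with $Y$ and $N$ the two coordinates; the conditioning is on the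
  sigma-algebra generated by $Y+N$.\<close>

definition mmse :: "real measure \<Rightarrow> real" where
  "mmse Q = (let M = Q \<Otimes>\<^sub>M gaussian 0 1;
                 F = vimage_algebra (space M) (\<lambda>\<omega>. fst \<omega> + snd \<omega>) borel
             in integral\<^sup>L M (cond_var M F fst))"

text \<open>The costs are extended nonnegative reals, so that controllers with infinite second moment
  have cost \<open>\<infinity>\<close> (the Bochner integral would assign them \<open>0\<close>).\<close>

definition witsenhausen_cost ::
  "'a measure \<Rightarrow> ('a \<Rightarrow> real) \<Rightarrow> ('a \<Rightarrow> real) \<Rightarrow> real \<Rightarrow> (real \<Rightarrow> real) \<Rightarrow> (real \<Rightarrow> real) \<Rightarrow> ennreal" where
  "witsenhausen_cost M X0 N k \<gamma>\<^sub>1 \<gamma>\<^sub>2 =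
     (let U1 = (\<lambda>\<omega>. \<gamma>\<^sub>1 (X0 \<omega>));
          Y = (\<lambda>\<omega>. X0 \<omega> + U1 \<omega>);
          U2 = (\<lambda>\<omega>. \<gamma>\<^sub>2 (Y \<omega> + N \<omega>))
      in ennreal (k\<^sup>2) * (\<integral>\<^sup>+ \<omega>. ennreal ((U1 \<omega>)\<^sup>2) \<partial>M) + (\<integral>\<^sup>+ \<omega>. ennreal ((Y \<omega> - U2 \<omega>)\<^sup>2) \<partial>M))"

definition witsenhausen_value ::
  "'a measure \<Rightarrow> ('a \<Rightarrow> real) \<Rightarrow> ('a \<Rightarrow> real) \<Rightarrow> real \<Rightarrow> ennreal" where
  "witsenhausen_value M X0 N k =
     (INF (\<gamma>\<^sub>1, \<gamma>\<^sub>2)\<in>borel_measurable borel \<times> borel_measurable borel. witsenhausen_cost M X0 N k \<gamma>\<^sub>1 \<gamma>\<^sub>2)"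

definition transport_objective :: "real \<Rightarrow> real measure \<Rightarrow> real measure \<Rightarrow> ennreal" where
  "transport_objective k P Q = ennreal (k\<^sup>2) * W2_sq P Q + ennreal (mmse Q)"

end

theory Submission
  imports Defs
begin

text \<open>The first controller enters the cost only through the coupling of \<open>X\<^sub>0\<close> and \<open>Y\<close>, and the second
  stage only through the law \<open>Q\<close> of \<open>Y\<close>; given \<open>Q\<close>, the best second controller is the posterior
  mean. Since \<open>P\<close> has no atoms, the quadratic transport problem from \<open>P\<close> to \<open>Q\<close> is solved, uniquely,
  by the monotone rearrangement, so relaxing from deterministic controllers to couplings does not lower
  the value. For the existence of a minimizer, second moments stay bounded along a minimizing sequence
  \<open>Q\<^sub>n\<close>, so a subsequence converges weakly and its monotone rearrangements converge \<open>P\<close>-almost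
  everywhere. As \<open>y \<mapsto> y \<phi>(z - y)\<close> is bounded, the posterior means converge pointwise, and writing
  the objective as one double integral of a nonnegative function of \<open>(x, z)\<close> gives lower
  semicontinuity by Fatou's lemma.\<close>

section \<open>Quadratic transport on the line\<close>

text \<open>The primitive of \<open>f\<close> works: over an interval it grows by at least the left
  and at most the right endpoint value of \<open>f\<close> times the length, which are the two
  halves of the subgradient inequality.\<close>

lemma mono_imp_subgradient:
  fixes f :: "real \<Rightarrow> real"
  assumes "mono f"
  obtains \<phi> where "\<And>x y. \<phi> x + f x * (y - x) \<le> \<phi> y" "\<phi> 0 = 0"
proof -
  \<comment> \<open>The signed integral from 0 to \<open>x\<close>: for \<open>x\<close> nonzero,
    the reversed one of the two intervals is empty and contributes 0.\<close>
  define \<phi> where "\<phi> x = integral {0..x} f - integral {x..0} f" for x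
  have int: "f integrable_on {a..b}" for a b
    using assms by (intro integrable_on_mono_on) (auto simp: mono_def mono_on_def)
  have diff: "\<phi> b - \<phi> a = integral {a..b} f" if "a \<le> b" for a b
  proof -
    consider "0 \<le> a" | "a < 0" "0 \<le> b" | "b < 0" by linarith
    then show ?thesis
    proof cases
      case 1
      then show ?thesis
        using that Henstock_Kurzweil_Integration.integral_combine[OF _ that int, of 0]
        by (cases "a = 0"; cases "b = 0") (auto simp: \<phi>_def)
    next
      case 2
      then show ?thesis
        using Henstock_Kurzweil_Integration.integral_combine[OF _ _ int, of a 0 b]
        by (cases "b = 0") (auto simp: \<phi>_def)
    next
      case 3
      then show ?thesis
        using that Henstock_Kurzweil_Integration.integral_combine[OF that _ int, of 0]
        by (auto simp: \<phi>_def)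
    qed
  qed
  have le: "f a * (b - a) \<le> \<phi> b - \<phi> a" if "a \<le> b" for a b
  proof -
    have "integral {a..b} (\<lambda>_. f a) \<le> integral {a..b} f"
      using assms by (intro integral_le int) (auto simp: mono_def)
    then show ?thesis using that by (simp add: diff mult.commute)
  qed
  have ge: "\<phi> b - \<phi> a \<le> f b * (b - a)" if "a \<le> b" for a b
  proof -
    have "integral {a..b} f \<le> integral {a..b} (\<lambda>_. f b)"
      using assms by (intro integral_le int) (auto simp: mono_def)
    then show ?thesis using that by (simp add: diff mult.commute)
  qed
  show ?thesis
  proof (rule that)
    show "\<phi> x + f x * (y - x) \<le> \<phi> y" for x y
      using le[of x y] ge[of y x] by (cases "x \<le> y") (auto simp: algebra_simps)
    show "\<phi> 0 = 0" by (simp add: \<phi>_def)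
  qed
qed

text \<open>Averaging the subgradient inequalities at a convex combination \<open>z\<close> cancels
  the linear terms and gives convexity; a finite convex function on the open line is
  continuous.\<close>

lemma subgradient_imp_continuous:
  fixes \<phi> g :: "real \<Rightarrow> real"
  assumes "\<And>x y. \<phi> x + g x * (y - x) \<le> \<phi> y"
  shows "continuous_on UNIV \<phi>"
proof (rule convex_on_continuous)
  show "convex_on UNIV \<phi>"
  proof (rule convex_onI)
    fix t x y :: real
    assume t: "0 < t" "t < 1"
    define z where "z = (1 - t) *\<^sub>R x + t *\<^sub>R y"
    have "(1 - t) * (\<phi> z + g z * (x - z)) + t * (\<phi> z + g z * (y - z)) \<le> (1 - t) * \<phi> x + t * \<phi> y"
      using t assms by (intro add_mono mult_left_mono) auto
    moreover have "(1 - t) * (\<phi> z + g z * (x - z)) + t * (\<phi> z + g z * (y - z)) = \<phi> z"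
      by (simp add: z_def algebra_simps)
    ultimately show "\<phi> ((1 - t) *\<^sub>R x + t *\<^sub>R y) \<le> (1 - t) * \<phi> x + t * \<phi> y"
      by (simp add: z_def)
  qed auto
qed auto

text \<open>Serves the equality case of the duality bound; finiteness of the integral is what allows
  subtracting it.\<close>

lemma AE_eq_if_nn_integral_eq:
  assumes [measurable]: "f \<in> borel_measurable M" "g \<in> borel_measurable M"
    and "AE x in M. f x \<le> g x" "(\<integral>\<^sup>+x. f x \<partial>M) = (\<integral>\<^sup>+x. g x \<partial>M)" "(\<integral>\<^sup>+x. f x \<partial>M) < \<infinity>"
  shows "AE x in M. g x = f x"
proof -
  have "(\<integral>\<^sup>+x. g x - f x \<partial>M) = 0"
    using assms by (subst nn_integral_diff) auto
  then have "AE x in M. g x - f x = 0"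
    by (subst (asm) nn_integral_0_iff_AE) auto
  then show ?thesis
    using assms(3) by eventually_elim (auto simp: diff_eq_0_iff_ennreal intro: antisym)
qed

text \<open>Kantorovich duality: a potential \<open>\<phi>\<close> with derivative \<open>f - f 0\<close> and its conjugate \<open>S\<close> are
  nonnegative, so everything can be integrated without integrability conditions; Young's inequality
  is tight exactly on the subdifferential of \<open>\<phi>\<close>.\<close>

lemma monotone_map_cost_le_coupling_cost:
  fixes f :: "real \<Rightarrow> real"
  assumes mono: "mono f" and P: "P \<in> P2" and int_f: "integrable P (\<lambda>x. (f x)\<^sup>2)"
    and \<pi>: "\<pi> \<in> couplings P (distr P borel f)"
  shows "(\<integral>\<^sup>+x. ennreal ((x - f x)\<^sup>2) \<partial>P) \<le> (\<integral>\<^sup>+z. ennreal ((fst z - snd z)\<^sup>2) \<partial>\<pi>)"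
    and "(\<integral>\<^sup>+x. ennreal ((x - f x)\<^sup>2) \<partial>P) = (\<integral>\<^sup>+z. ennreal ((fst z - snd z)\<^sup>2) \<partial>\<pi>) \<Longrightarrow>
      AE z in \<pi>. \<forall>x. (x < fst z \<longrightarrow> f x \<le> snd z) \<and> (fst z < x \<longrightarrow> snd z \<le> f x)"
proof -
  let ?Cf = "\<integral>\<^sup>+x. ennreal ((x - f x)\<^sup>2) \<partial>P" and ?C = "\<integral>\<^sup>+z. ennreal ((fst z - snd z)\<^sup>2) \<partial>\<pi>"
  interpret P: prob_space P using P by (simp add: P2_def)
  have sets_P[measurable_cong]: "sets P = sets borel" and int_x: "integrable P (\<lambda>x. x\<^sup>2)"
    using P by (auto simp: P2_def)
  have f_meas[measurable]: "f \<in> borel_measurable borel"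
    using mono by (rule borel_measurable_mono)
  have sets_\<pi>[measurable_cong]: "sets \<pi> = sets (borel \<Otimes>\<^sub>M borel)" and "prob_space \<pi>"
    and fst_\<pi>: "distr \<pi> borel fst = P" and snd_\<pi>: "distr \<pi> borel snd = distr P borel f"
    using \<pi> by (auto simp: couplings_def)
  \<comment> \<open>Shifting by \<open>f 0\<close> makes the slope \<open>g\<close> vanish at 0, so
    \<open>\<phi>\<close> is minimal there and hence nonnegative.\<close>
  define c where "c = f 0"
  define g where "g x = f x - c" for x
  have "mono g" using mono by (auto simp: mono_def g_def)
  then obtain \<phi> where sub: "\<And>x y. \<phi> x + g x * (y - x) \<le> \<phi> y" and \<phi>0: "\<phi> 0 = 0"
    by (rule mono_imp_subgradient) blast
  have \<phi>_nonneg: "0 \<le> \<phi> x" for x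
    using sub[of 0 x] by (simp add: \<phi>0 g_def c_def)
  have \<phi>_cont: "continuous_on UNIV \<phi>"
    using sub by (rule subgradient_imp_continuous)
  then have [measurable]: "\<phi> \<in> borel_measurable borel"
    by (rule borel_measurable_continuous_onI)
  \<comment> \<open>Only rational \<open>q\<close>, so that \<open>S\<close> is a countable supremum
    and measurable; density and continuity of \<open>\<phi>\<close> recover Young's inequality for
    all reals. Truncation by \<open>ennreal\<close> is harmless, since \<open>q = 0\<close> already
    contributes the value 0.\<close>
  define S where "S y = (SUP q\<in>\<rat>. ennreal (q * (y - c) - \<phi> q))" for y
  have [measurable]: "S \<in> borel_measurable borel"
    unfolding S_def by (intro borel_measurable_SUP countable_rat) measurable
  have young: "ennreal (x * (y - c) - \<phi> x) \<le> S y" for x y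
  proof -
    have "closed {x. ennreal (x * (y - c) - \<phi> x) \<le> S y}"
      by (intro closed_Collect_le continuous_intros continuous_on_ennreal \<phi>_cont)
    moreover have "\<rat> \<subseteq> {x. ennreal (x * (y - c) - \<phi> x) \<le> S y}"
      unfolding S_def by (auto intro: SUP_upper)
    ultimately have "closure \<rat> \<subseteq> {x. ennreal (x * (y - c) - \<phi> x) \<le> S y}"
      by (intro closure_minimal)
    then show ?thesis by (auto simp: Rats_closure_real)
  qed
  have S_f: "S (f x) = ennreal (x * g x - \<phi> x)" for x
  proof (rule antisym)
    have "q * g x - \<phi> q \<le> x * g x - \<phi> x" for q
      using sub[of x q] by (simp add: algebra_simps)
    then show "S (f x) \<le> ennreal (x * g x - \<phi> x)"
      unfolding S_def by (intro SUP_least ennreal_leI) (simp add: g_def)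
    show "ennreal (x * g x - \<phi> x) \<le> S (f x)"
      using young[of x "f x"] by (simp add: g_def)
  qed
  have conj_nonneg: "0 \<le> x * g x - \<phi> x" for x
    using sub[of x 0] by (simp add: \<phi>0 algebra_simps)
  \<comment> \<open>Based on \<open>(x - y)\<^sup>2 + 2 * x * (y - c) + c\<^sup>2 = (x - c)\<^sup>2
    + y\<^sup>2\<close>: replacing \<open>x * (y - c)\<close> by the larger
    \<open>\<phi> x + S y\<close> turns the left side into \<open>R\<close>, and the right side is
    \<open>L\<close>. Both \<open>A\<close> and \<open>L\<close> are sums of functions of one
    coordinate, so their integrals depend on the marginals only.\<close>
  define A where "A z = ennreal (2 * \<phi> (fst z) + c\<^sup>2) + 2 * S (snd z)" for z :: "real \<times> real"
  define L where "L z = ennreal ((fst z - c)\<^sup>2 + (snd z)\<^sup>2)" for z :: "real \<times> real"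
  define R where "R z = ennreal ((fst z - snd z)\<^sup>2) + A z" for z :: "real \<times> real"
  have [measurable]: "A \<in> borel_measurable (borel \<Otimes>\<^sub>M borel)" "L \<in> borel_measurable (borel \<Otimes>\<^sub>M borel)"
      "R \<in> borel_measurable (borel \<Otimes>\<^sub>M borel)"
    unfolding A_def L_def R_def by measurable
  have LR: "L z \<le> R z" 
    and LR_eq: "R z = L z \<Longrightarrow> S (snd z) = ennreal (fst z * (snd z - c) - \<phi> (fst z)) \<and> 0 \<le> fst z * (snd z - c) - \<phi> (fst z)" for z
  proof -
    obtain x y where z: "z = (x, y)" by (cases z)
    show "L z \<le> R z"
    proof (cases "S y")
      case (real s)
      then have s: "x * (y - c) - \<phi> x \<le> s"
        using young[of x y] by (auto simp: ennreal_le_iff2)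
      have "R z = ennreal ((x - y)\<^sup>2 + (2 * \<phi> x + c\<^sup>2 + 2 * s))"
        using real \<phi>_nonneg[of x] by (simp add: R_def A_def z ennreal_mult' flip: ennreal_numeral)
      also have "\<dots> \<ge> L z"
        unfolding L_def z using s by (intro ennreal_leI) (simp add: power2_eq_square algebra_simps)
      finally show ?thesis .
    qed (simp add: R_def A_def z ennreal_mult_top)
    \<comment> \<open>\<open>L\<close> is finite, so equality rules out
      \<open>S y = \<infinity>\<close> and makes Young's inequality tight.\<close>
    show "S (snd z) = ennreal (fst z * (snd z - c) - \<phi> (fst z)) \<and> 0 \<le> fst z * (snd z - c) - \<phi> (fst z)" if eq: "R z = L z"
    proof (cases "S y")
      case (real s)
      have "R z = ennreal ((x - y)\<^sup>2 + (2 * \<phi> x + c\<^sup>2 + 2 * s))"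
        using real \<phi>_nonneg[of x] by (simp add: R_def A_def z ennreal_mult' flip: ennreal_numeral)
      with eq have "ennreal ((x - y)\<^sup>2 + (2 * \<phi> x + c\<^sup>2 + 2 * s)) = ennreal ((x - c)\<^sup>2 + y\<^sup>2)"
        by (simp only: L_def z fst_conv snd_conv)
      then have "(x - y)\<^sup>2 + (2 * \<phi> x + c\<^sup>2 + 2 * s) = (x - c)\<^sup>2 + y\<^sup>2"
        using real \<phi>_nonneg[of x] by (subst (asm) ennreal_inj) auto
      then have "s = x * (y - c) - \<phi> x"
        by (simp add: power2_eq_square algebra_simps)
      then show ?thesis using real by (simp add: z)
    next
      case top
      then show ?thesis using eq by (simp add: R_def A_def L_def z ennreal_mult_top del: ennreal_plus)
    qed
  qed
  have R_f: "R (x, f x) = L (x, f x)" for x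
  proof -
    define s where "s = x * g x - \<phi> x"
    have "S (f x) = ennreal s" "0 \<le> s"
      using S_f conj_nonneg[of x] by (auto simp: s_def)
    then have "R (x, f x) = ennreal ((x - f x)\<^sup>2 + (2 * \<phi> x + c\<^sup>2 + 2 * s))"
      using \<phi>_nonneg[of x] by (simp add: R_def A_def ennreal_mult' flip: ennreal_numeral)
    also have "\<dots> = L (x, f x)"
      unfolding L_def by (intro arg_cong[where f=ennreal]) (simp add: s_def g_def power2_eq_square algebra_simps)
    finally show ?thesis .
  qed
  have marg: "(\<integral>\<^sup>+z. a (fst z) + b (snd z) \<partial>\<pi>) = (\<integral>\<^sup>+x. a x + b (f x) \<partial>P)"
    if [measurable]: "a \<in> borel_measurable borel" "b \<in> borel_measurable borel" for a b :: "real \<Rightarrow> ennreal"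
  proof -
    have "(\<integral>\<^sup>+z. a (fst z) + b (snd z) \<partial>\<pi>) = (\<integral>\<^sup>+z. a (fst z) \<partial>\<pi>) + (\<integral>\<^sup>+z. b (snd z) \<partial>\<pi>)"
      by (intro nn_integral_add) measurable
    also have "(\<integral>\<^sup>+z. a (fst z) \<partial>\<pi>) = (\<integral>\<^sup>+x. a x \<partial>distr \<pi> borel fst)"
      by (subst nn_integral_distr) measurable
    also have "(\<integral>\<^sup>+z. b (snd z) \<partial>\<pi>) = (\<integral>\<^sup>+x. b x \<partial>distr \<pi> borel snd)"
      by (subst nn_integral_distr) measurable
    also have "\<dots> = (\<integral>\<^sup>+x. b (f x) \<partial>P)"
      unfolding snd_\<pi> by (subst nn_integral_distr) measurable
    finally show ?thesis
      by (simp add: fst_\<pi> nn_integral_add)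
  qed
  have A_eq: "(\<integral>\<^sup>+z. A z \<partial>\<pi>) = (\<integral>\<^sup>+x. A (x, f x) \<partial>P)"
    unfolding A_def using marg[of "\<lambda>x. ennreal (2 * \<phi> x + c\<^sup>2)" "\<lambda>y. 2 * S y"] by simp
  have L_eq: "(\<integral>\<^sup>+z. L z \<partial>\<pi>) = (\<integral>\<^sup>+x. L (x, f x) \<partial>P)"
    unfolding L_def using marg[of "\<lambda>x. ennreal ((x - c)\<^sup>2)" "\<lambda>y. ennreal (y\<^sup>2)"] by simp
  have int1: "integrable P (\<lambda>x. x)"
    by (rule P.square_integrable_imp_integrable) (use int_x in auto)
  have "integrable P (\<lambda>x. x\<^sup>2 + c\<^sup>2 - 2 * c * x + (f x)\<^sup>2)"
    using int_x int1 int_f by simp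
  also have "(\<lambda>x. x\<^sup>2 + c\<^sup>2 - 2 * c * x + (f x)\<^sup>2) = (\<lambda>x. (x - c)\<^sup>2 + (f x)\<^sup>2)"
    by (simp add: power2_diff algebra_simps)
  finally have "(\<integral>\<^sup>+x. L (x, f x) \<partial>P) < \<infinity>"
    unfolding L_def by (subst nn_integral_eq_integral) (auto simp del: ennreal_plus)
  then have L_fin: "(\<integral>\<^sup>+z. L z \<partial>\<pi>) < \<infinity>" by (simp add: L_eq)
  have R_split: "(\<integral>\<^sup>+z. R z \<partial>\<pi>) = ?C + (\<integral>\<^sup>+z. A z \<partial>\<pi>)"
    unfolding R_def by (intro nn_integral_add) measurable
  have Rf_split: "(\<integral>\<^sup>+x. R (x, f x) \<partial>P) = ?Cf + (\<integral>\<^sup>+z. A z \<partial>\<pi>)"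
    unfolding R_def A_eq by (subst nn_integral_add) auto
  have L_split: "(\<integral>\<^sup>+z. L z \<partial>\<pi>) = ?Cf + (\<integral>\<^sup>+z. A z \<partial>\<pi>)"
    by (simp add: L_eq Rf_split[symmetric] R_f)
  \<comment> \<open>Second moments make the integral of \<open>L\<close> finite, and that of
    \<open>A\<close> is a summand of it; this licenses cancelling the latter from both
    sides.\<close>
  have A_fin: "(\<integral>\<^sup>+z. A z \<partial>\<pi>) \<noteq> \<infinity>"
    using L_fin L_split by auto
  have "?Cf + (\<integral>\<^sup>+z. A z \<partial>\<pi>) \<le> ?C + (\<integral>\<^sup>+z. A z \<partial>\<pi>)"
    unfolding L_split[symmetric] R_split[symmetric] by (intro nn_integral_mono LR)
  then show "?Cf \<le> ?C"
    using A_fin by (simp add: add.commute[of _ "\<integral>\<^sup>+z. A z \<partial>\<pi>"] ennreal_add_left_cancel_le)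
  assume "?Cf = ?C"
  then have "AE z in \<pi>. R z = L z"
    using L_fin by (intro AE_eq_if_nn_integral_eq) (auto simp: LR L_split R_split)
  then show "AE z in \<pi>. \<forall>x. (x < fst z \<longrightarrow> f x \<le> snd z) \<and> (fst z < x \<longrightarrow> snd z \<le> f x)"
  proof eventually_elim
    case (elim z)
    obtain x y where z: "z = (x, y)" by (cases z)
    have S: "S y = ennreal (x * (y - c) - \<phi> x)" "0 \<le> x * (y - c) - \<phi> x"
      using LR_eq[OF elim] by (auto simp: z)
    \<comment> \<open>Tightness says that \<open>y - c\<close> is a subgradient of
      \<open>\<phi>\<close> at \<open>x\<close>; adding the subgradient inequality at
      \<open>x'\<close> eliminates \<open>\<phi>\<close>.\<close>
    have le: "(x' - x) * (y - c) \<le> (x' - x) * (f x' - c)" for x'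
    proof -
      have "x' * (y - c) - \<phi> x' \<le> x * (y - c) - \<phi> x"
        using young[of x' y] S by (auto simp: ennreal_le_iff2)
      then show ?thesis
        using sub[of x' x] by (simp add: g_def algebra_simps)
    qed
    show ?case
    proof (intro allI conjI impI)
      fix x'
      show "f x' \<le> snd z" if "x' < fst z"
        using le[of x'] that by (simp add: z mult_le_cancel_left_neg)
      show "snd z \<le> f x'" if "fst z < x'"
        using le[of x'] that by (simp add: z mult_le_cancel_left_pos)
    qed
  qed
qed

section \<open>Quantile functions and the monotone rearrangement\<close>

text \<open>The Galois connection behind all computations with quantiles; it rests on
  right-continuity of the cdf. For other \<open>u\<close> the set in \<open>quantile\<close> may be
  empty or unbounded below, where \<open>Inf\<close> on the reals carries no information.\<close>

lemma quantile_le_iff: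
  assumes "real_distribution Q" "0 < u" "u < 1"
  shows "quantile Q u \<le> y \<longleftrightarrow> u \<le> cdf Q y"
proof -
  interpret cdf_distribution Q using assms by (simp add: cdf_distribution_def)
  show ?thesis
    using pseudoinverse[of u y] assms by (simp add: quantile_def)
qed

lemma mono_on_quantile:
  assumes "real_distribution Q"
  shows "mono_on {0<..<1} (quantile Q)"
proof -
  interpret cdf_distribution Q using assms by (simp add: cdf_distribution_def)
  show ?thesis
    using mono_I by (simp add: quantile_def[abs_def])
qed

lemma P2_real_distribution: "Q \<in> P2 \<Longrightarrow> real_distribution Q"
  by (simp add: P2_def real_distribution_def real_distribution_axioms_def)

text \<open>A map induces the coupling carried by its graph, which makes the cost of a map
  comparable with \<open>W2_sq\<close>.\<close>

lemma map_coupling: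
  fixes T :: "real \<Rightarrow> real"
  assumes "real_distribution P" and T[measurable]: "T \<in> borel_measurable borel"
  defines "\<pi> \<equiv> distr P (borel \<Otimes>\<^sub>M borel) (\<lambda>x. (x, T x))"
  shows "\<pi> \<in> couplings P (distr P borel T)"
    and "(\<integral>\<^sup>+z. ennreal ((fst z - snd z)\<^sup>2) \<partial>\<pi>) = (\<integral>\<^sup>+x. ennreal ((x - T x)\<^sup>2) \<partial>P)"
proof -
  interpret real_distribution P by fact
  have "distr P borel (\<lambda>x. x) = P"
    by (rule distr_id2) simp
  then show "\<pi> \<in> couplings P (distr P borel T)"
    unfolding couplings_def \<pi>_def by (auto simp: distr_distr comp_def intro!: prob_space_distr)
  show "(\<integral>\<^sup>+z. ennreal ((fst z - snd z)\<^sup>2) \<partial>\<pi>) = (\<integral>\<^sup>+x. ennreal ((x - T x)\<^sup>2) \<partial>P)"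
    unfolding \<pi>_def by (subst nn_integral_distr) auto
qed

text \<open>What the argument uses of the Gaussian law. Absence of atoms makes \<open>cdf P\<close>
  uniformly distributed under \<open>P\<close>; the strict bounds keep \<open>cdf P x\<close> in the
  range where \<open>quantile\<close> is a true generalized inverse at every \<open>x\<close>, so
  the rearrangement is monotone on the whole line.\<close>

locale transport_source = real_distribution P for P +
  assumes atomless: "measure P {x} = 0"
    and cdf_pos: "0 < cdf P x" and cdf_less_1: "cdf P x < 1"
    and second_moment: "integrable P (\<lambda>x. x\<^sup>2)"
begin

lemma P_in_P2: "P \<in> P2"
  using second_moment prob_space_axioms by (simp add: P2_def)

text \<open>Without atoms the cdf is continuous: its left limit at the quantile is at most
  \<open>u\<close> and its value there at least \<open>u\<close>, so it equals
  \<open>u\<close>.\<close>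

lemma measure_cdf_less:
  assumes u: "0 < u" "u < 1"
  shows "measure P {x. cdf P x < u} = u"
proof -
  let ?q = "quantile P u"
  have iff: "u \<le> cdf P x \<longleftrightarrow> ?q \<le> x" for x
    using quantile_le_iff[OF real_distribution_axioms u] by simp
  then have less_iff: "cdf P x < u \<longleftrightarrow> x < ?q" for x
    using iff[of x] by linarith
  have "((cdf P) \<longlongrightarrow> cdf P ?q) (at_left ?q)"
    using isCont_cdf[of ?q] atomless[of ?q] by (simp add: isCont_def filterlim_at_split)
  moreover have "\<forall>\<^sub>F x in at_left ?q. cdf P x \<le> u"
    by (auto simp: eventually_at_filter less_iff[THEN iffD2] less_imp_le)
  ultimately have "cdf P ?q \<le> u"
    by (rule tendsto_upperbound) simp
  then have q: "cdf P ?q = u" using iff[of ?q] by simp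
  have "{x. cdf P x < u} = {..?q} - {?q}"
    unfolding less_iff by (auto simp: less_le)
  moreover have "measure P ({..?q} - {?q}) = measure P {..?q} - measure P {?q}"
    by (rule finite_measure_Diff) auto
  ultimately show ?thesis
    using q atomless[of ?q] by (simp add: cdf_def)
qed

text \<open>Interior levels are squeezed between the strict sublevel sets at \<open>u\<close> and at
  \<open>w > u\<close>; the strict bounds on \<open>cdf P\<close> settle the endpoints.\<close>

lemma measure_cdf_le:
  assumes u: "0 \<le> u" "u \<le> 1"
  shows "measure P {x. cdf P x \<le> u} = u"
proof -
  have [measurable]: "cdf P \<in> borel_measurable borel"
    by (intro borel_measurable_mono monoI cdf_nondecreasing)
  consider "u = 0" | "u = 1" | "0 < u" "u < 1" using u by linarith
  then show ?thesis
  proof cases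
    case 1
    then have "{x. cdf P x \<le> u} = {}" using cdf_pos by (auto simp: not_le)
    then show ?thesis using 1 by simp
  next
    case 2
    then have "{x. cdf P x \<le> u} = UNIV" using cdf_less_1 by (auto intro: less_imp_le)
    then show ?thesis using 2 prob_space by simp
  next
    case 3
    have "measure P {x. cdf P x < u} \<le> measure P {x. cdf P x \<le> u}"
      by (intro finite_measure_mono) auto
    moreover have "measure P {x. cdf P x \<le> u} \<le> u"
    proof (rule dense_ge_bounded[OF 3(2)])
      fix w assume w: "u < w" "w < 1"
      have "measure P {x. cdf P x \<le> u} \<le> measure P {x. cdf P x < w}"
        using w by (intro finite_measure_mono) auto
      then show "measure P {x. cdf P x \<le> u} \<le> w"
        using measure_cdf_less[of w] w 3 by simp
    qed
    ultimately show ?thesis using measure_cdf_less[OF 3] by simp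
  qed
qed

lemma countable_null:
  assumes "countable D"
  shows "AE x in P. x \<notin> D"
proof -
  have "emeasure P {d} = 0" for d
    unfolding emeasure_eq_measure atomless by simp
  then have "{d} \<in> null_sets P" for d
    by (intro null_setsI) simp_all
  then have "(\<Union>d\<in>D. {d}) \<in> null_sets P"
    by (rule null_sets_UN'[OF assms])
  then show ?thesis by (intro AE_not_in) simp
qed

text \<open>Each level set of \<open>cdf P\<close> is null by uniformity. This later discards the
  countably many jumps of a quantile function.\<close>

lemma AE_cdf_notin_countable:
  assumes "countable D"
  shows "AE x in P. cdf P x \<notin> D"
proof -
  have [measurable]: "cdf P \<in> borel_measurable borel"
    by (intro borel_measurable_mono monoI cdf_nondecreasing)
  have "{x. cdf P x = u} \<in> null_sets P" for u
  proof (cases "0 < u \<and> u < 1")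
    case True
    have "measure P ({x. cdf P x \<le> u} - {x. cdf P x < u}) = measure P {x. cdf P x \<le> u} - measure P {x. cdf P x < u}"
      by (rule finite_measure_Diff) auto
    moreover have "{x. cdf P x \<le> u} - {x. cdf P x < u} = {x. cdf P x = u}" by auto
    ultimately have "measure P {x. cdf P x = u} = 0"
      using True by (simp add: measure_cdf_le measure_cdf_less)
    then have "emeasure P {x. cdf P x = u} = 0"
      unfolding emeasure_eq_measure by simp
    then show ?thesis
      by (intro null_setsI) simp_all
  next
    case False
    then have "{x. cdf P x = u} = {}" using cdf_pos cdf_less_1 by auto
    then show ?thesis by simp
  qed
  then have "(\<Union>u\<in>D. {x. cdf P x = u}) \<in> null_sets P"
    by (rule null_sets_UN'[OF assms])
  from AE_not_in[OF this] show ?thesis by eventually_elim auto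
qed

lemma monotone_rearrangement_le_iff:
  "real_distribution Q \<Longrightarrow> monotone_rearrangement P Q x \<le> y \<longleftrightarrow> cdf P x \<le> cdf Q y"
  unfolding monotone_rearrangement_def by (intro quantile_le_iff cdf_pos cdf_less_1)

lemma mono_monotone_rearrangement:
  assumes "real_distribution Q"
  shows "mono (monotone_rearrangement P Q)"
  using mono_on_quantile[OF assms] cdf_pos cdf_less_1
  by (auto simp: monotone_rearrangement_def mono_on_def intro!: monoI cdf_nondecreasing)

lemma measurable_monotone_rearrangement:
  "real_distribution Q \<Longrightarrow> monotone_rearrangement P Q \<in> borel_measurable borel"
  by (intro borel_measurable_mono mono_monotone_rearrangement)

text \<open>By the Galois connection the event that the map is at most \<open>y\<close> is
  \<open>cdf P x \<le> cdf Q y\<close>, whose probability is \<open>cdf Q y\<close> by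
  uniformity.\<close>

lemma distr_monotone_rearrangement:
  assumes Q: "real_distribution Q"
  shows "distr P borel (monotone_rearrangement P Q) = Q"
proof (rule cdf_unique)
  interpret Q: real_distribution Q by fact
  note [measurable] = measurable_monotone_rearrangement[OF Q]
  show "real_distribution (distr P borel (monotone_rearrangement P Q))" by simp
  show "cdf (distr P borel (monotone_rearrangement P Q)) = cdf Q"
  proof
    fix y
    have "cdf (distr P borel (monotone_rearrangement P Q)) y
        = measure P {x. monotone_rearrangement P Q x \<le> y}"
      by (simp add: cdf_def measure_distr vimage_def)
    also have "\<dots> = cdf Q y"
      using Q.cdf_nonneg Q.cdf_bounded_prob by (simp add: monotone_rearrangement_le_iff[OF Q] measure_cdf_le)
    finally show "cdf (distr P borel (monotone_rearrangement P Q)) y = cdf Q y" .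
  qed
qed (fact Q)

context
  fixes Q assumes Q: "Q \<in> P2"
begin

lemma monotone_rearrangement_le_coupling:
  assumes "\<pi> \<in> couplings P Q"
  defines "f \<equiv> monotone_rearrangement P Q"
  shows "(\<integral>\<^sup>+x. ennreal ((x - f x)\<^sup>2) \<partial>P) \<le> (\<integral>\<^sup>+z. ennreal ((fst z - snd z)\<^sup>2) \<partial>\<pi>)"
    and "(\<integral>\<^sup>+x. ennreal ((x - f x)\<^sup>2) \<partial>P) = (\<integral>\<^sup>+z. ennreal ((fst z - snd z)\<^sup>2) \<partial>\<pi>) \<Longrightarrow>
      AE z in \<pi>. \<forall>x. (x < fst z \<longrightarrow> f x \<le> snd z) \<and> (fst z < x \<longrightarrow> snd z \<le> f x)"
proof -
  note QD = P2_real_distribution[OF Q]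
  note [measurable] = measurable_monotone_rearrangement[OF QD]
  have "integrable (distr P borel f) (\<lambda>x. x\<^sup>2)"
    using Q by (simp add: f_def distr_monotone_rearrangement QD P2_def)
  then have "integrable P (\<lambda>x. (f x)\<^sup>2)"
    by (subst (asm) integrable_distr_eq) (auto simp: f_def)
  moreover have "mono f" "\<pi> \<in> couplings P (distr P borel f)"
    using assms by (simp_all add: f_def mono_monotone_rearrangement distr_monotone_rearrangement QD)
  ultimately show "(\<integral>\<^sup>+x. ennreal ((x - f x)\<^sup>2) \<partial>P) \<le> (\<integral>\<^sup>+z. ennreal ((fst z - snd z)\<^sup>2) \<partial>\<pi>)"
    "(\<integral>\<^sup>+x. ennreal ((x - f x)\<^sup>2) \<partial>P) = (\<integral>\<^sup>+z. ennreal ((fst z - snd z)\<^sup>2) \<partial>\<pi>) \<Longrightarrow>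
      AE z in \<pi>. \<forall>x. (x < fst z \<longrightarrow> f x \<le> snd z) \<and> (fst z < x \<longrightarrow> snd z \<le> f x)"
    using monotone_map_cost_le_coupling_cost[OF _ P_in_P2, of f \<pi>] by blast+
qed

lemma W2_sq_monotone_rearrangement:
  "W2_sq P Q = (\<integral>\<^sup>+x. ennreal ((x - monotone_rearrangement P Q x)\<^sup>2) \<partial>P)"
proof (rule antisym)
  note QD = P2_real_distribution[OF Q]
  note mc = map_coupling[OF real_distribution_axioms measurable_monotone_rearrangement[OF QD]]
  show "W2_sq P Q \<le> (\<integral>\<^sup>+x. ennreal ((x - monotone_rearrangement P Q x)\<^sup>2) \<partial>P)"
    unfolding W2_sq_def mc(2)[symmetric]
    by (intro INF_lower) (use mc(1) in \<open>simp add: distr_monotone_rearrangement QD\<close>)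
  show "(\<integral>\<^sup>+x. ennreal ((x - monotone_rearrangement P Q x)\<^sup>2) \<partial>P) \<le> W2_sq P Q"
    unfolding W2_sq_def by (intro INF_greatest monotone_rearrangement_le_coupling(1))
qed

lemma optimal_transport_map_monotone_rearrangement:
  "optimal_transport_map P Q (monotone_rearrangement P Q)"
  using P2_real_distribution[OF Q]
  by (simp add: optimal_transport_map_def measurable_monotone_rearrangement
      distr_monotone_rearrangement W2_sq_monotone_rearrangement)

text \<open>The graph of an optimal map is an optimal coupling, so the equality case of duality puts
  \<open>T x\<close> between the one-sided limits of the rearrangement at \<open>x\<close>. These
  agree off countably many jumps, a null set of \<open>P\<close>.\<close>

lemma optimal_transport_map_unique:
  assumes T: "optimal_transport_map P Q T"
  shows "AE x in P. T x = monotone_rearrangement P Q x"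
proof -
  let ?f = "monotone_rearrangement P Q"
  note QD = P2_real_distribution[OF Q]
  have mono: "mono ?f" by (rule mono_monotone_rearrangement[OF QD])
  have T_meas[measurable]: "T \<in> borel_measurable borel" and T_distr: "distr P borel T = Q"
    and T_opt: "(\<integral>\<^sup>+x. ennreal ((x - T x)\<^sup>2) \<partial>P) = (\<integral>\<^sup>+x. ennreal ((x - ?f x)\<^sup>2) \<partial>P)"
    using T by (auto simp: optimal_transport_map_def W2_sq_monotone_rearrangement)
  note mc = map_coupling[OF real_distribution_axioms T_meas]
  have AE: "AE z in distr P (borel \<Otimes>\<^sub>M borel) (\<lambda>x. (x, T x)).
      \<forall>x. (x < fst z \<longrightarrow> ?f x \<le> snd z) \<and> (fst z < x \<longrightarrow> snd z \<le> ?f x)"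
    using mc T_distr T_opt by (intro monotone_rearrangement_le_coupling(2)) auto
  then have "AE x in P. \<forall>x'. (x' < x \<longrightarrow> ?f x' \<le> T x) \<and> (x < x' \<longrightarrow> T x \<le> ?f x')"
    using AE_distrD[OF _ AE] by simp
  moreover have "AE x in P. x \<notin> {x. \<not> isCont ?f x}"
    by (intro countable_null mono_ctble_discont mono)
  ultimately show ?thesis
  proof eventually_elim
    case (elim x)
    then have cont: "(?f \<longlongrightarrow> ?f x) (at_left x)" "(?f \<longlongrightarrow> ?f x) (at_right x)"
      by (simp_all add: isCont_def filterlim_at_split)
    have "?f x \<le> T x"
      by (rule tendsto_upperbound[OF cont(1)])
         (use elim in \<open>auto simp: eventually_at_filter intro!: always_eventually\<close>)
    moreover have "T x \<le> ?f x"
      by (rule tendsto_lowerbound[OF cont(2)])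
         (use elim in \<open>auto simp: eventually_at_filter intro!: always_eventually\<close>)
    ultimately show ?case by simp
  qed
qed

end

end

section \<open>The posterior mean in Gaussian noise\<close>

abbreviation \<phi> :: "real \<Rightarrow> real" where
  "\<phi> \<equiv> std_normal_density"

lemma real_distribution_gaussian: "0 < \<sigma> \<Longrightarrow> real_distribution (gaussian \<mu> \<sigma>)"
  unfolding gaussian_def
  by (simp add: real_distribution_def real_distribution_axioms_def prob_space_normal_density)

text \<open>Bayes' formula for the mean of \<open>Y\<close> given \<open>Y + N = z\<close>, with
  likelihood \<open>\<phi> (z - y)\<close>; the denominator is the density of \<open>Y + N\<close>
  at \<open>z\<close>. Unlike a conditional expectation it is defined at every
  \<open>z\<close>.\<close>

definition posterior_mean :: "real measure \<Rightarrow> real \<Rightarrow> real" where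
  "posterior_mean Q z = (\<integral>y. y * \<phi> (z - y) \<partial>Q) / (\<integral>y. \<phi> (z - y) \<partial>Q)"

lemma std_normal_density_le_exp: "\<phi> u \<le> exp (- (u\<^sup>2 / 2))"
proof -
  have "1 \<le> sqrt (2 * pi)"
    using pi_ge_two by (simp add: real_le_rsqrt)
  then have "1 / sqrt (2 * pi) * exp (- (u\<^sup>2 / 2)) \<le> 1 * exp (- (u\<^sup>2 / 2))"
    by (intro mult_right_mono) (simp_all add: divide_le_eq)
  then show ?thesis by (simp add: std_normal_density_def)
qed

lemma std_normal_density_le_1: "\<phi> u \<le> 1"
  by (rule order_trans[OF std_normal_density_le_exp]) simp

lemma abs_mult_std_normal_density_le: "\<bar>u\<bar> * \<phi> u \<le> 1"
proof -
  have "0 \<le> (\<bar>u\<bar> - 1)\<^sup>2" by simp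
  then have "\<bar>u\<bar> \<le> 1 + u\<^sup>2 / 2" by (simp add: power2_diff)
  also have "\<dots> \<le> exp (u\<^sup>2 / 2)" by (rule exp_ge_add_one_self)
  finally have "\<bar>u\<bar> * exp (- (u\<^sup>2 / 2)) \<le> 1"
    by (simp add: exp_minus divide_simps)
  then show ?thesis
    using mult_left_mono[OF std_normal_density_le_exp[of u], of "\<bar>u\<bar>"] by simp
qed

text \<open>Splits \<open>y\<close> into \<open>z\<close> and \<open>y - z\<close>. The bound is
  uniform in \<open>y\<close>, so the numerator of \<open>posterior_mean\<close> exists without
  moment conditions and passes to limits.\<close>

lemma abs_mult_shifted_std_normal_density_le: "\<bar>y * \<phi> (z - y)\<bar> \<le> \<bar>z\<bar> + 1"
proof -
  have p: "0 \<le> \<phi> (z - y)" by simp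
  have "\<bar>y * \<phi> (z - y)\<bar> = \<bar>y\<bar> * \<phi> (z - y)" using p by (simp add: abs_mult)
  also have "\<dots> \<le> (\<bar>z\<bar> + \<bar>z - y\<bar>) * \<phi> (z - y)"
    using p by (intro mult_right_mono) auto
  also have "\<dots> \<le> \<bar>z\<bar> * 1 + 1"
    unfolding distrib_right
    by (intro add_mono mult_left_mono std_normal_density_le_1 abs_mult_std_normal_density_le) auto
  finally show ?thesis by simp
qed

context real_distribution
begin

lemma integrable_shifted_density: "integrable M (\<lambda>y. \<phi> (z - y))"
  by (rule integrable_const_bound[of _ 1]) (auto simp: std_normal_density_le_1)

lemma integrable_mult_shifted_density: "integrable M (\<lambda>y. y * \<phi> (z - y))"
  by (rule integrable_const_bound[of _ "\<bar>z\<bar> + 1"])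
     (auto simp: abs_mult_shifted_std_normal_density_le simp del: abs_mult)

lemma output_density_pos: "0 < (\<integral>y. \<phi> (z - y) \<partial>M)"
proof -
  have total: "emeasure M UNIV = 1" using emeasure_space_1 by simp
  have "(\<integral>y. 0 \<partial>M) < (\<integral>y. \<phi> (z - y) \<partial>M)"
    by (rule integral_less_AE_space)
       (auto simp: integrable_shifted_density normal_density_pos total)
  then show ?thesis by simp
qed

lemma measurable_posterior_mean[measurable]: "posterior_mean M \<in> borel_measurable borel"
  unfolding posterior_mean_def[abs_def] by measurable

text \<open>The substitution \<open>z = y + n\<close> turns the independent noise into the
  transition density of the channel from \<open>Y\<close> to \<open>Y + N\<close>.\<close>

lemma nn_integral_channel:
  fixes h :: "real \<times> real \<Rightarrow> ennreal"
  assumes [measurable]: "h \<in> borel_measurable (borel \<Otimes>\<^sub>M borel)"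
  shows "(\<integral>\<^sup>+\<omega>. h (fst \<omega>, fst \<omega> + snd \<omega>) \<partial>(M \<Otimes>\<^sub>M gaussian 0 1))
    = (\<integral>\<^sup>+y. \<integral>\<^sup>+z. h (y, z) * ennreal (\<phi> (z - y)) \<partial>lborel \<partial>M)"
proof -
  interpret N: real_distribution "gaussian 0 1" by (rule real_distribution_gaussian) simp
  have "(\<integral>\<^sup>+\<omega>. h (fst \<omega>, fst \<omega> + snd \<omega>) \<partial>(M \<Otimes>\<^sub>M gaussian 0 1))
      = (\<integral>\<^sup>+y. \<integral>\<^sup>+n. h (y, y + n) \<partial>gaussian 0 1 \<partial>M)"
    by (subst N.nn_integral_fst[symmetric]) auto
  also have "\<dots> = (\<integral>\<^sup>+y. \<integral>\<^sup>+n. ennreal (\<phi> n) * h (y, y + n) \<partial>lborel \<partial>M)"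
    unfolding gaussian_def by (intro nn_integral_cong) (simp add: nn_integral_density)
  also have "\<dots> = (\<integral>\<^sup>+y. \<integral>\<^sup>+z. h (y, z) * ennreal (\<phi> (z - y)) \<partial>lborel \<partial>M)"
  proof (rule nn_integral_cong)
    fix y
    show "(\<integral>\<^sup>+n. ennreal (\<phi> n) * h (y, y + n) \<partial>lborel) = (\<integral>\<^sup>+z. h (y, z) * ennreal (\<phi> (z - y)) \<partial>lborel)"
      using nn_integral_real_affine[of "\<lambda>z. h (y, z) * ennreal (\<phi> (z - y))" 1 y]
      by (simp add: mult.commute)
  qed
  finally show ?thesis .
qed

end

section \<open>Least-squares estimation and the mmse\<close>

locale P2_law = real_distribution Q for Q +
  assumes second_moment: "integrable Q (\<lambda>x. x\<^sup>2)"
begin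

text \<open>For fixed \<open>z\<close> the right side is the quadratic
  \<open>s - 2 * a * m + a\<^sup>2 * p\<close> in \<open>a\<close>, finite by the second moment of
  \<open>Q\<close>; completing the square gives the minimizer \<open>m / p\<close>.\<close>

lemma posterior_mean_minimizes:
  "(\<integral>\<^sup>+y. ennreal ((y - posterior_mean Q z)\<^sup>2) * ennreal (\<phi> (z - y)) \<partial>Q)
    \<le> (\<integral>\<^sup>+y. ennreal ((y - a)\<^sup>2) * ennreal (\<phi> (z - y)) \<partial>Q)"
proof -
  let ?w = "\<lambda>y. \<phi> (z - y)"
  define p where "p = (\<integral>y. ?w y \<partial>Q)"
  define m where "m = (\<integral>y. y * ?w y \<partial>Q)"
  define s where "s = (\<integral>y. y\<^sup>2 * ?w y \<partial>Q)"
  have p: "0 < p" unfolding p_def by (rule output_density_pos)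
  have int2: "integrable Q (\<lambda>y. y\<^sup>2 * ?w y)"
  proof (rule Bochner_Integration.integrable_bound[OF second_moment])
    show "AE y in Q. norm (y\<^sup>2 * ?w y) \<le> norm (y\<^sup>2)"
      using mult_left_mono[OF std_normal_density_le_1] by (intro AE_I2) (simp add: abs_mult)
  qed simp
  note int = int2 integrable_shifted_density[of z] integrable_mult_shifted_density[of z]
  have eq: "(\<integral>\<^sup>+y. ennreal ((y - a)\<^sup>2) * ennreal (?w y) \<partial>Q) = ennreal (s - 2 * a * m + a\<^sup>2 * p)" for a
  proof -
    have split: "(y - a)\<^sup>2 * ?w y = y\<^sup>2 * ?w y - (2 * a) * (y * ?w y) + a\<^sup>2 * ?w y" for y
      by (simp add: power2_diff algebra_simps)
    have int_a: "integrable Q (\<lambda>y. (y - a)\<^sup>2 * ?w y)"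
      unfolding split using int by simp
    have "(\<integral>\<^sup>+y. ennreal ((y - a)\<^sup>2) * ennreal (?w y) \<partial>Q) = (\<integral>\<^sup>+y. ennreal ((y - a)\<^sup>2 * ?w y) \<partial>Q)"
      by (simp add: ennreal_mult')
    also have "\<dots> = ennreal (\<integral>y. (y - a)\<^sup>2 * ?w y \<partial>Q)"
      using int_a by (intro nn_integral_eq_integral) auto
    also have "(\<integral>y. (y - a)\<^sup>2 * ?w y \<partial>Q) = s - 2 * a * m + a\<^sup>2 * p"
      unfolding split using int by (simp add: s_def m_def p_def)
    finally show ?thesis .
  qed
  have "s - 2 * (m / p) * m + (m / p)\<^sup>2 * p \<le> s - 2 * a * m + a\<^sup>2 * p"
  proof -
    have "0 \<le> (a - m / p)\<^sup>2 * p" using p by simp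
    also have "\<dots> = (s - 2 * a * m + a\<^sup>2 * p) - (s - 2 * (m / p) * m + (m / p)\<^sup>2 * p)"
      using p by (simp add: power2_diff field_simps power2_eq_square)
    finally show ?thesis by simp
  qed
  then show ?thesis
    unfolding eq posterior_mean_def p_def[symmetric] m_def[symmetric] by (rule ennreal_leI)
qed

text \<open>Tonelli puts the observation \<open>z\<close> outermost, and then the pointwise
  minimization applies for each \<open>z\<close> separately.\<close>

lemma estimation_error_ge:
  assumes [measurable]: "\<gamma> \<in> borel_measurable borel"
  shows "(\<integral>\<^sup>+\<omega>. ennreal ((fst \<omega> - posterior_mean Q (fst \<omega> + snd \<omega>))\<^sup>2) \<partial>(Q \<Otimes>\<^sub>M gaussian 0 1))
    \<le> (\<integral>\<^sup>+\<omega>. ennreal ((fst \<omega> - \<gamma> (fst \<omega> + snd \<omega>))\<^sup>2) \<partial>(Q \<Otimes>\<^sub>M gaussian 0 1))"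
proof -
  interpret QL: pair_sigma_finite Q lborel ..
  have eq: "(\<integral>\<^sup>+\<omega>. ennreal ((fst \<omega> - c (fst \<omega> + snd \<omega>))\<^sup>2) \<partial>(Q \<Otimes>\<^sub>M gaussian 0 1))
    = (\<integral>\<^sup>+z. \<integral>\<^sup>+y. ennreal ((y - c z)\<^sup>2) * ennreal (\<phi> (z - y)) \<partial>Q \<partial>lborel)"
    if [measurable]: "c \<in> borel_measurable borel" for c
    using nn_integral_channel[of "\<lambda>w. ennreal ((fst w - c (snd w))\<^sup>2)"]
    by (simp add: QL.Fubini')
  show ?thesis
    unfolding eq[OF measurable_posterior_mean] eq[OF assms]
    by (intro nn_integral_mono posterior_mean_minimizes)
qed

text \<open>The posterior mean is identified with the conditional expectation variationally: being
  the best function of \<open>Y + N\<close>, it leaves an error orthogonal to indicators of events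
  in \<open>Y + N\<close>, which characterizes the conditional expectation.\<close>

lemma mmse_eq_posterior_error:
  "ennreal (mmse Q) =
    (\<integral>\<^sup>+\<omega>. ennreal ((fst \<omega> - posterior_mean Q (fst \<omega> + snd \<omega>))\<^sup>2) \<partial>(Q \<Otimes>\<^sub>M gaussian 0 1))"
proof -
  interpret N: real_distribution "gaussian 0 1" by (rule real_distribution_gaussian) simp
  define M where "M = Q \<Otimes>\<^sub>M gaussian 0 1"
  define Z where "Z \<omega> = fst \<omega> + snd \<omega>" for \<omega> :: "real \<times> real"
  define F where "F = vimage_algebra (space M) Z borel"
  define g where "g = posterior_mean Q"
  interpret QN: pair_prob_space Q "gaussian 0 1" ..
  interpret M: prob_space M unfolding M_def by (rule QN.prob_space_axioms)
  have [measurable_cong]: "sets M = sets (borel \<Otimes>\<^sub>M borel)"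
    unfolding M_def by (intro sets_pair_measure_cong) auto
  have [measurable]: "g \<in> borel_measurable borel" by (simp add: g_def)
  have Z_meas[measurable]: "Z \<in> borel_measurable M" unfolding Z_def by measurable
  have Z_F: "Z \<in> borel_measurable F"
    unfolding F_def by (rule measurable_vimage_algebra1) simp
  have "subalgebra M F"
    unfolding subalgebra_def F_def
    by (auto simp: sets_vimage_algebra2 intro!: measurable_sets[OF Z_meas])
  then interpret F: finite_measure_subalgebra M F
    by unfold_locales
  have int_Y2: "integrable M (\<lambda>\<omega>. (fst \<omega>)\<^sup>2)"
  proof -
    have "distr M borel fst = Q"
      unfolding M_def using N.distr_pair_fst[of Q] distr_cong[OF refl events_eq_borel[symmetric]] by metis
    then show ?thesis
      using second_moment integrable_distr_eq[of fst M borel "\<lambda>x. x\<^sup>2"] by simp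
  qed
  have int_Y: "integrable M fst"
    by (rule M.square_integrable_imp_integrable) (use int_Y2 in auto)
  define D where "D \<omega> = fst \<omega> - g (Z \<omega>)" for \<omega>
  have [measurable]: "D \<in> borel_measurable M" unfolding D_def by measurable
  have min: "(\<integral>\<^sup>+\<omega>. ennreal ((D \<omega>)\<^sup>2) \<partial>M) \<le> (\<integral>\<^sup>+\<omega>. ennreal ((fst \<omega> - \<gamma> (Z \<omega>))\<^sup>2) \<partial>M)"
    if "\<gamma> \<in> borel_measurable borel" for \<gamma>
    using estimation_error_ge[OF that] by (simp add: D_def g_def Z_def M_def)
  \<comment> \<open>The zero estimator has the second moment of \<open>Q\<close> as its error, so
    the smallest error is finite.\<close>
  have int_D2: "integrable M (\<lambda>\<omega>. (D \<omega>)\<^sup>2)"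
  proof (rule integrableI_nonneg)
    show "(\<integral>\<^sup>+\<omega>. ennreal ((D \<omega>)\<^sup>2) \<partial>M) < \<infinity>"
      using min[of "\<lambda>_. 0"] int_Y2
      by (auto simp: nn_integral_eq_integral intro: le_less_trans)
  qed auto
  have int_D: "integrable M D"
    by (rule M.square_integrable_imp_integrable) (use int_D2 in auto)
  have int_gZ: "integrable M (\<lambda>\<omega>. g (Z \<omega>))"
    using Bochner_Integration.integrable_diff[OF int_Y int_D] by (simp add: D_def)
  \<comment> \<open>First-order condition: adding \<open>c\<close> times the indicator of \<open>B\<close> to the minimizer \<open>g\<close>,
    with \<open>c\<close> the correlation itself, would otherwise lower the error.\<close>
  have orth: "(\<integral>\<omega>. D \<omega> * indicator B (Z \<omega>) \<partial>M) = 0" if [measurable]: "B \<in> sets borel" for B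
  proof -
    let ?b = "\<lambda>\<omega>. indicator B (Z \<omega>) :: real"
    define c where "c = (\<integral>\<omega>. D \<omega> * ?b \<omega> \<partial>M)"
    have int_b: "integrable M ?b"
      by (rule M.integrable_const_bound[of _ 1]) auto
    have int_Db: "integrable M (\<lambda>\<omega>. D \<omega> * ?b \<omega>)"
      by (rule Bochner_Integration.integrable_bound[OF int_D]) (auto simp: indicator_def)
    have split: "(fst \<omega> - (g (Z \<omega>) + c * ?b \<omega>))\<^sup>2 = (D \<omega>)\<^sup>2 - (2 * c) * (D \<omega> * ?b \<omega>) + c\<^sup>2 * ?b \<omega>" for \<omega>
      by (auto simp: D_def indicator_def power2_eq_square algebra_simps)
    have int: "integrable M (\<lambda>\<omega>. (fst \<omega> - (g (Z \<omega>) + c * ?b \<omega>))\<^sup>2)"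
      unfolding split using int_D2 int_b int_Db by simp
    have "ennreal (\<integral>\<omega>. (D \<omega>)\<^sup>2 \<partial>M) \<le> ennreal (\<integral>\<omega>. (fst \<omega> - (g (Z \<omega>) + c * ?b \<omega>))\<^sup>2 \<partial>M)"
      using min[of "\<lambda>z. g z + c * indicator B z"] int int_D2 by (simp add: nn_integral_eq_integral)
    then have "(\<integral>\<omega>. (D \<omega>)\<^sup>2 \<partial>M) \<le> (\<integral>\<omega>. (fst \<omega> - (g (Z \<omega>) + c * ?b \<omega>))\<^sup>2 \<partial>M)"
      by (subst (asm) ennreal_le_iff) auto
    also have "\<dots> = (\<integral>\<omega>. (D \<omega>)\<^sup>2 \<partial>M) - 2 * c * c + c\<^sup>2 * (\<integral>\<omega>. ?b \<omega> \<partial>M)"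
      unfolding split using int_D2 int_b int_Db by (simp add: c_def)
    finally have "2 * c\<^sup>2 \<le> c\<^sup>2 * (\<integral>\<omega>. ?b \<omega> \<partial>M)"
      by (simp add: power2_eq_square)
    also have "\<dots> \<le> c\<^sup>2 * 1"
    proof (intro mult_left_mono)
      have "(\<integral>\<omega>. ?b \<omega> \<partial>M) \<le> (\<integral>\<omega>. 1 \<partial>M)"
        using int_b by (intro integral_mono) auto
      then show "(\<integral>\<omega>. ?b \<omega> \<partial>M) \<le> 1" by (simp add: M.prob_space)
    qed simp
    finally have "c\<^sup>2 \<le> 0" by simp
    then show ?thesis by (simp add: c_def)
  qed
  have ce: "AE \<omega> in M. real_cond_exp M F fst \<omega> = g (Z \<omega>)"
  proof (rule F.real_cond_exp_charact)
    fix A assume "A \<in> sets F"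
    then obtain B where B: "B \<in> sets borel" "A = Z -` B \<inter> space M"
      unfolding F_def by (subst (asm) sets_vimage_algebra2) auto
    have "(\<integral>\<omega>\<in>A. fst \<omega> \<partial>M) - (\<integral>\<omega>\<in>A. g (Z \<omega>) \<partial>M) = (\<integral>\<omega>\<in>A. D \<omega> \<partial>M)"
    proof -
      have "A \<in> sets M" using B by simp
      then show ?thesis
        unfolding D_def
        by (subst set_integral_diff(2)) (auto simp: set_integrable_def int_Y int_gZ intro!: integrable_mult_indicator simp del: real_scaleR_def)
    qed
    also have "\<dots> = (\<integral>\<omega>. D \<omega> * indicator B (Z \<omega>) \<partial>M)"
      unfolding set_lebesgue_integral_def using B
      by (intro Bochner_Integration.integral_cong) (auto simp: indicator_def)
    finally show "(\<integral>\<omega>\<in>A. fst \<omega> \<partial>M) = (\<integral>\<omega>\<in>A. g (Z \<omega>) \<partial>M)"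
      using orth[OF B(1)] by simp
  next
    show "(\<lambda>\<omega>. g (Z \<omega>)) \<in> borel_measurable F"
      using Z_F by measurable
  qed (use int_Y int_gZ in auto)
  let ?e = "\<lambda>\<omega>. (fst \<omega> - real_cond_exp M F fst \<omega>)\<^sup>2"
  have ae: "AE \<omega> in M. ?e \<omega> = (D \<omega>)\<^sup>2"
    using ce by eventually_elim (simp add: D_def)
  have "integrable M ?e"
    using int_D2 by (subst integrable_cong_AE[OF _ _ ae]) auto
  \<comment> \<open>The expectation of a conditional expectation removes the outer conditioning in
    \<open>cond_var\<close>.\<close>
  then have "mmse Q = (\<integral>\<omega>. ?e \<omega> \<partial>M)"
    using F.real_cond_exp_int(2)[of ?e]
    by (simp add: mmse_def Let_def cond_var_def M_def[symmetric] F_def[unfolded Z_def, symmetric])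
  also have "\<dots> = (\<integral>\<omega>. (D \<omega>)\<^sup>2 \<partial>M)"
    using ae by (intro integral_cong_AE) auto
  finally show ?thesis
    using int_D2 by (simp add: nn_integral_eq_integral[symmetric] D_def g_def Z_def M_def)
qed

lemma mmse_eq_double_integral:
  "ennreal (mmse Q) =
    (\<integral>\<^sup>+y. \<integral>\<^sup>+z. ennreal ((y - posterior_mean Q z)\<^sup>2) * ennreal (\<phi> (z - y)) \<partial>lborel \<partial>Q)"
  unfolding mmse_eq_posterior_error
  using nn_integral_channel[of "\<lambda>w. ennreal ((fst w - posterior_mean Q (snd w))\<^sup>2)"] by simp

end

lemma P2_law: "Q \<in> P2 \<Longrightarrow> P2_law Q"
  using P2_real_distribution by (simp add: P2_law_def P2_law_axioms_def P2_def)

section \<open>Existence of a minimizer\<close>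

text \<open>Chebyshev's inequality with one cut-off for the whole sequence.\<close>

lemma second_moment_bound_imp_tight:
  assumes Q: "\<And>n. Q n \<in> P2" and C: "\<And>n. (\<integral>x. x\<^sup>2 \<partial>Q n) \<le> C"
  shows "tight Q"
  unfolding tight_def
proof (intro conjI allI impI)
  show "real_distribution (Q n)" for n by (rule P2_real_distribution[OF Q])
  fix \<epsilon> :: real assume \<epsilon>: "0 < \<epsilon>"
  \<comment> \<open>Chosen so that
    \<open>\<epsilon> * a\<^sup>2 = \<bar>C\<bar> + \<epsilon>\<close>, which strictly exceeds
    \<open>C\<close>; the summand 1 also keeps \<open>a\<close> positive.\<close>
  define a where "a = sqrt (\<bar>C\<bar> / \<epsilon> + 1)"
  have a2: "a\<^sup>2 = \<bar>C\<bar> / \<epsilon> + 1" and a: "0 < a"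
    using \<epsilon> by (auto simp: a_def intro: add_nonneg_pos)
  have "1 - \<epsilon> < measure (Q n) {-a<..a}" for n
  proof -
    interpret P2_law "Q n" by (rule P2_law[OF Q])
    have "measure (Q n) {x \<in> space (Q n). a\<^sup>2 \<le> x\<^sup>2} \<le> (\<integral>x. x\<^sup>2 \<partial>Q n) / a\<^sup>2"
      using a by (intro integral_Markov_inequality_measure[OF second_moment, of "{}"]) auto
    also have "\<dots> \<le> C / a\<^sup>2"
      using C by (intro divide_right_mono) auto
    also have "\<dots> < \<epsilon>"
    proof -
      have "C < \<epsilon> * a\<^sup>2" using \<epsilon> by (simp add: a2 distrib_left)
      then show ?thesis using a by (simp add: divide_less_eq)
    qed
    finally have "measure (Q n) {x \<in> space (Q n). a\<^sup>2 \<le> x\<^sup>2} < \<epsilon>" .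
    moreover have "measure (Q n) (space (Q n) - {x \<in> space (Q n). a\<^sup>2 \<le> x\<^sup>2})
        = 1 - measure (Q n) {x \<in> space (Q n). a\<^sup>2 \<le> x\<^sup>2}"
      by (intro prob_compl) auto
    moreover have "measure (Q n) (space (Q n) - {x \<in> space (Q n). a\<^sup>2 \<le> x\<^sup>2}) \<le> measure (Q n) {-a<..a}"
    proof (intro finite_measure_mono)
      show "space (Q n) - {x \<in> space (Q n). a\<^sup>2 \<le> x\<^sup>2} \<subseteq> {-a<..a}"
      proof
        fix x assume "x \<in> space (Q n) - {x \<in> space (Q n). a\<^sup>2 \<le> x\<^sup>2}"
        then have "x\<^sup>2 < a\<^sup>2" by auto
        then have "\<bar>x\<bar> < a" using a power2_less_imp_less[of "\<bar>x\<bar>" a] by simp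
        then show "x \<in> {-a<..a}" by auto
      qed
    qed auto
    ultimately show ?thesis by linarith
  qed
  then show "\<exists>a b. a < b \<and> (\<forall>n. 1 - \<epsilon> < measure (Q n) {a<..b})"
    using a by (intro exI[of _ "-a"] exI[of _ a]) auto
qed

text \<open>The quantiles are trapped between points that are not atoms of \<open>Q\<close>: there
  the cdfs converge, and such points are dense because the atoms are countable.\<close>

lemma weak_conv_m_imp_quantile_tendsto:
  assumes Qs: "\<And>n. real_distribution (Qs n)" and Q: "real_distribution Q"
    and conv: "weak_conv_m Qs Q" and u: "0 < u" "u < 1" and cont: "isCont (quantile Q) u"
  shows "(\<lambda>n. quantile (Qs n) u) \<longlonglongrightarrow> quantile Q u"
proof -
  interpret Q: real_distribution Q by fact
  have cdf_conv: "(\<lambda>n. cdf (Qs n) y) \<longlonglongrightarrow> cdf Q y" if "measure Q {y} = 0" for y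
    using conv that Q.isCont_cdf[of y] by (simp add: weak_conv_m_def weak_conv_def)
  have dense: "\<exists>y. a < y \<and> y < b \<and> measure Q {y} = 0" if "a < b" for a b
    using open_minus_countable[OF Q.countable_support, of "{a<..<b}"] that by auto
  show ?thesis
  proof (rule order_tendstoI)
    fix a assume "a < quantile Q u"
    then obtain y where y: "a < y" "y < quantile Q u" "measure Q {y} = 0"
      using dense by blast
    then have "cdf Q y < u"
      using quantile_le_iff[OF Q u, of y] by linarith
    then have "\<forall>\<^sub>F n in sequentially. cdf (Qs n) y < u"
      by (rule order_tendstoD(2)[OF cdf_conv[OF y(3)]])
    then show "\<forall>\<^sub>F n in sequentially. a < quantile (Qs n) u"
    proof eventually_elim
      case (elim n)
      then show ?case using quantile_le_iff[OF Qs u, of n y] y(1) by linarith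
    qed
  next
    \<comment> \<open>At level \<open>u\<close> itself one only gets \<open>u \<le> cdf Q y\<close>,
      which need not survive approximation. Continuity at \<open>u\<close> supplies a level
      \<open>v > u\<close> still below \<open>b\<close>, making the inequality strict.\<close>
    fix b assume "quantile Q u < b"
    moreover have "(quantile Q \<longlongrightarrow> quantile Q u) (at_right u)"
      using cont by (simp add: isCont_def filterlim_at_split)
    ultimately have "\<forall>\<^sub>F v in at_right u. quantile Q v < b"
      by (intro order_tendstoD(2))
    moreover have "\<forall>\<^sub>F v in at_right u. v \<in> {u<..<1}"
      using u by (intro eventually_at_right_real)
    ultimately have "\<forall>\<^sub>F v in at_right u. quantile Q v < b \<and> u < v \<and> v < 1"
      by eventually_elim auto
    then obtain v where v: "quantile Q v < b" "u < v" "v < 1"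
      using eventually_happens'[OF trivial_limit_at_right_real] by blast
    obtain y where y: "quantile Q v < y" "y < b" "measure Q {y} = 0"
      using dense[OF v(1)] by blast
    have "v \<le> cdf Q y"
      using quantile_le_iff[OF Q, of v y] u v y by simp
    then have "u < cdf Q y" using v by simp
    then have "\<forall>\<^sub>F n in sequentially. u < cdf (Qs n) y"
      by (rule order_tendstoD(1)[OF cdf_conv[OF y(3)]])
    then show "\<forall>\<^sub>F n in sequentially. quantile (Qs n) u < b"
    proof eventually_elim
      case (elim n)
      then show ?case using quantile_le_iff[OF Qs u, of n y] y(2) by linarith
    qed
  qed
qed

lemma countable_discont_quantile:
  assumes "real_distribution Q"
  shows "countable {u \<in> {0<..<1}. \<not> isCont (quantile Q) u}"
  using mono_on_ctble_discont[OF mono_on_quantile[OF assms]]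
  by (simp add: at_within_open[of _ "{0 <..< 1}"] cong: conj_cong)

text \<open>Convergence can fail only where \<open>cdf P x\<close> hits a jump of
  \<open>quantile Q\<close>, and this has probability 0 under \<open>P\<close>.\<close>

lemma (in transport_source) weak_conv_m_imp_AE_monotone_rearrangement_tendsto:
  assumes Qs: "\<And>n. real_distribution (Qs n)" and Q: "real_distribution Q"
    and conv: "weak_conv_m Qs Q"
  shows "AE x in P. (\<lambda>n. monotone_rearrangement P (Qs n) x) \<longlonglongrightarrow> monotone_rearrangement P Q x"
  using AE_cdf_notin_countable[OF countable_discont_quantile[OF Q]]
proof eventually_elim
  case (elim x)
  then show ?case
    unfolding monotone_rearrangement_def using cdf_pos[of x] cdf_less_1[of x]
    by (intro weak_conv_m_imp_quantile_tendsto Qs Q conv) auto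
qed

section \<open>Lower semicontinuity of the objective\<close>

text \<open>Both terms of the transport objective are put under a single integral so that Fatou's lemma
  applies to them at once.\<close>

definition map_objective :: "real \<Rightarrow> real measure \<Rightarrow> (real \<Rightarrow> real) \<Rightarrow> ennreal" where
  "map_objective k P f = (\<integral>\<^sup>+x. \<integral>\<^sup>+z. ennreal ((k\<^sup>2 * (x - f x)\<^sup>2 +
     (f x - posterior_mean (distr P borel f) z)\<^sup>2) * \<phi> (z - f x)) \<partial>lborel \<partial>P)"

lemma nn_integral_shifted_density: "(\<integral>\<^sup>+z. ennreal (\<phi> (z - y)) \<partial>lborel) = 1"
proof -
  have "\<phi> (z - y) = normal_density y 1 z" for z by (simp add: normal_density_def)
  then show ?thesis by (simp add: nn_integral_eq_integral)
qed

context real_distribution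
begin

text \<open>The transport term does not involve \<open>z\<close>, and
  \<open>\<phi> (z - f x)\<close> has total mass 1 in \<open>z\<close>, so moving that term under
  the inner integral preserves it.\<close>

lemma map_objective_eq:
  assumes [measurable]: "f \<in> borel_measurable borel"
  shows "map_objective k M f = ennreal (k\<^sup>2) * (\<integral>\<^sup>+x. ennreal ((x - f x)\<^sup>2) \<partial>M) +
    (\<integral>\<^sup>+y. \<integral>\<^sup>+z. ennreal ((y - posterior_mean (distr M borel f) z)\<^sup>2) * ennreal (\<phi> (z - y))
      \<partial>lborel \<partial>distr M borel f)"
proof -
  interpret Q: real_distribution "distr M borel f" by simp
  let ?g = "posterior_mean (distr M borel f)"
  have "(\<integral>\<^sup>+z. ennreal ((k\<^sup>2 * (x - f x)\<^sup>2 + (f x - ?g z)\<^sup>2) * \<phi> (z - f x)) \<partial>lborel)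
      = ennreal (k\<^sup>2) * ennreal ((x - f x)\<^sup>2) +
        (\<integral>\<^sup>+z. ennreal ((f x - ?g z)\<^sup>2) * ennreal (\<phi> (z - f x)) \<partial>lborel)" for x
  proof -
    have "(\<integral>\<^sup>+z. ennreal ((k\<^sup>2 * (x - f x)\<^sup>2 + (f x - ?g z)\<^sup>2) * \<phi> (z - f x)) \<partial>lborel)
        = (\<integral>\<^sup>+z. ennreal (k\<^sup>2 * (x - f x)\<^sup>2) * ennreal (\<phi> (z - f x)) +
              ennreal ((f x - ?g z)\<^sup>2) * ennreal (\<phi> (z - f x)) \<partial>lborel)"
      by (intro nn_integral_cong) (simp add: ennreal_mult distrib_right)
    also have "\<dots> = ennreal (k\<^sup>2 * (x - f x)\<^sup>2) +
        (\<integral>\<^sup>+z. ennreal ((f x - ?g z)\<^sup>2) * ennreal (\<phi> (z - f x)) \<partial>lborel)"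
      by (simp add: nn_integral_add nn_integral_cmult nn_integral_shifted_density)
    finally show ?thesis by (simp add: ennreal_mult)
  qed
  then show ?thesis
    unfolding map_objective_def
    by (simp add: nn_integral_add nn_integral_cmult nn_integral_distr)
qed

text \<open>Numerator and denominator integrate bounded continuous functions of \<open>y\<close>, so
  dominated convergence applies to both; the limiting denominator is positive.\<close>

lemma tendsto_posterior_mean:
  assumes [measurable]: "\<And>n. fs n \<in> borel_measurable borel" "f \<in> borel_measurable borel"
    and conv: "AE x in M. (\<lambda>n. fs n x) \<longlonglongrightarrow> f x"
  shows "(\<lambda>n. posterior_mean (distr M borel (fs n)) z) \<longlonglongrightarrow> posterior_mean (distr M borel f) z"
proof -
  interpret Q: real_distribution "distr M borel f" by simp
  have \<phi>_cont: "isCont (\<lambda>y. \<phi> (z - y)) y" for y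
    unfolding std_normal_density_def by (intro continuous_intros) auto
  have lim: "(\<lambda>n. \<integral>y. h y \<partial>distr M borel (fs n)) \<longlonglongrightarrow> (\<integral>y. h y \<partial>distr M borel f)"
    if h: "\<And>y. isCont h y" and bound: "\<And>y. \<bar>h y\<bar> \<le> B" for h :: "real \<Rightarrow> real" and B
  proof -
    have [measurable]: "h \<in> borel_measurable borel"
      using h by (intro borel_measurable_continuous_onI continuous_at_imp_continuous_on) auto
    have "(\<lambda>n. \<integral>x. h (fs n x) \<partial>M) \<longlonglongrightarrow> (\<integral>x. h (f x) \<partial>M)"
    proof (rule integral_dominated_convergence[where w="\<lambda>_. B"])
      show "AE x in M. (\<lambda>n. h (fs n x)) \<longlonglongrightarrow> h (f x)"
        using conv by eventually_elim (rule isCont_tendsto_compose[OF h])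
    qed (use bound in auto)
    then show ?thesis by (simp add: integral_distr)
  qed
  show ?thesis
    unfolding posterior_mean_def
  proof (rule tendsto_divide)
    show "(\<lambda>n. \<integral>y. y * \<phi> (z - y) \<partial>distr M borel (fs n)) \<longlonglongrightarrow> (\<integral>y. y * \<phi> (z - y) \<partial>distr M borel f)"
      by (rule lim[OF _ abs_mult_shifted_std_normal_density_le]) (intro continuous_intros \<phi>_cont)
    show "(\<lambda>n. \<integral>y. \<phi> (z - y) \<partial>distr M borel (fs n)) \<longlonglongrightarrow> (\<integral>y. \<phi> (z - y) \<partial>distr M borel f)"
      by (rule lim[of _ 1]) (use \<phi>_cont std_normal_density_le_1 in auto)
    show "(\<integral>y. \<phi> (z - y) \<partial>distr M borel f) \<noteq> 0"
      using Q.output_density_pos[of z] by simp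
  qed
qed

text \<open>The integrand converges for every \<open>z\<close> and almost every \<open>x\<close>;
  Fatou's lemma is applied first in \<open>z\<close>, then in \<open>x\<close>.\<close>

lemma map_objective_lsc:
  assumes fs[measurable]: "\<And>n. fs n \<in> borel_measurable borel" and f[measurable]: "f \<in> borel_measurable borel"
    and conv: "AE x in M. (\<lambda>n. fs n x) \<longlonglongrightarrow> f x"
  shows "map_objective k M f \<le> liminf (\<lambda>n. map_objective k M (fs n))"
proof -
  interpret Q: real_distribution "distr M borel f" by simp
  interpret Qs: real_distribution "distr M borel (fs n)" for n by simp
  let ?I = "\<lambda>f x z. ennreal ((k\<^sup>2 * (x - f x)\<^sup>2 +
     (f x - posterior_mean (distr M borel f) z)\<^sup>2) * \<phi> (z - f x))"
  note [measurable] = Q.measurable_posterior_mean Qs.measurable_posterior_mean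
  have "AE x in M. (\<integral>\<^sup>+z. ?I f x z \<partial>lborel) \<le> liminf (\<lambda>n. \<integral>\<^sup>+z. ?I (fs n) x z \<partial>lborel)"
    using conv
  proof eventually_elim
    case (elim x)
    have "?I f x z = liminf (\<lambda>n. ?I (fs n) x z)" for z
    proof -
      have "isCont \<phi> y" for y
        unfolding std_normal_density_def by (intro continuous_intros) auto
      then have "(\<lambda>n. \<phi> (z - fs n x)) \<longlonglongrightarrow> \<phi> (z - f x)"
        by (rule isCont_tendsto_compose) (intro tendsto_intros elim)
      then have "(\<lambda>n. ?I (fs n) x z) \<longlonglongrightarrow> ?I f x z"
        by (intro tendsto_intros elim tendsto_posterior_mean fs f conv)
      then show ?thesis
        by (intro lim_imp_Liminf[symmetric]) auto
    qed
    then show ?case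
      by (simp only:) (rule nn_integral_liminf, simp)
  qed
  then have "map_objective k M f \<le> (\<integral>\<^sup>+x. liminf (\<lambda>n. \<integral>\<^sup>+z. ?I (fs n) x z \<partial>lborel) \<partial>M)"
    unfolding map_objective_def by (rule nn_integral_mono_AE)
  also have "\<dots> \<le> liminf (\<lambda>n. map_objective k M (fs n))"
    unfolding map_objective_def by (rule nn_integral_liminf) measurable
  finally show ?thesis .
qed

end

lemma (in transport_source) transport_objective_eq_map_objective:
  assumes Q: "Q \<in> P2"
  shows "transport_objective k P Q = map_objective k P (monotone_rearrangement P Q)"
proof -
  interpret Q: P2_law Q by (rule P2_law[OF Q])
  note QD = P2_real_distribution[OF Q]
  show ?thesis
    using map_objective_eq[OF measurable_monotone_rearrangement[OF QD], of k]
    by (simp add: transport_objective_def W2_sq_monotone_rearrangement[OF Q]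
        distr_monotone_rearrangement[OF QD] Q.mmse_eq_double_integral)
qed

section \<open>Moment bounds and the direct method\<close>

text \<open>Finite cost of moving mass forces a finite second moment of the image, by
  \<open>(f x)\<^sup>2 \<le> 2 * (x - f x)\<^sup>2 + 2 * x\<^sup>2\<close>, a rearrangement of
  \<open>0 \<le> (2 * x - f x)\<^sup>2\<close>. The explicit bound gives tightness of minimizing
  sequences.\<close>

lemma (in real_distribution) distr_in_P2:
  assumes [measurable]: "f \<in> borel_measurable borel" and M: "integrable M (\<lambda>x. x\<^sup>2)"
    and fin: "(\<integral>\<^sup>+x. ennreal ((x - f x)\<^sup>2) \<partial>M) < \<infinity>"
  shows "distr M borel f \<in> P2"
    and "ennreal (\<integral>y. y\<^sup>2 \<partial>distr M borel f) \<le> 2 * (\<integral>\<^sup>+x. ennreal ((x - f x)\<^sup>2) \<partial>M) + 2 * ennreal (\<integral>x. x\<^sup>2 \<partial>M)"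
proof -
  have bound: "(\<integral>\<^sup>+x. ennreal ((f x)\<^sup>2) \<partial>M) \<le> 2 * (\<integral>\<^sup>+x. ennreal ((x - f x)\<^sup>2) \<partial>M) + 2 * ennreal (\<integral>x. x\<^sup>2 \<partial>M)"
  proof -
    have "(f x)\<^sup>2 \<le> 2 * (x - f x)\<^sup>2 + 2 * x\<^sup>2" for x
      using zero_le_power2[of "2 * x - f x"] by (simp add: power2_eq_square algebra_simps)
    then have "ennreal ((f x)\<^sup>2) \<le> ennreal (2 * (x - f x)\<^sup>2 + 2 * x\<^sup>2)" for x
      by (intro ennreal_leI)
    then have le: "ennreal ((f x)\<^sup>2) \<le> 2 * ennreal ((x - f x)\<^sup>2) + 2 * ennreal (x\<^sup>2)" for x
      by (simp add: ennreal_mult)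
    have "(\<integral>\<^sup>+x. ennreal ((f x)\<^sup>2) \<partial>M) \<le> (\<integral>\<^sup>+x. 2 * ennreal ((x - f x)\<^sup>2) + 2 * ennreal (x\<^sup>2) \<partial>M)"
      by (intro nn_integral_mono le)
    also have "\<dots> = 2 * (\<integral>\<^sup>+x. ennreal ((x - f x)\<^sup>2) \<partial>M) + 2 * (\<integral>\<^sup>+x. ennreal (x\<^sup>2) \<partial>M)"
      by (simp add: nn_integral_add nn_integral_cmult)
    also have "(\<integral>\<^sup>+x. ennreal (x\<^sup>2) \<partial>M) = ennreal (\<integral>x. x\<^sup>2 \<partial>M)"
      using M by (intro nn_integral_eq_integral) auto
    finally show ?thesis .
  qed
  also have "\<dots> < \<infinity>" using fin by (simp add: ennreal_mult_less_top)
  finally have int: "integrable M (\<lambda>x. (f x)\<^sup>2)"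
    by (intro integrableI_nonneg) auto
  then show "distr M borel f \<in> P2"
    by (auto simp: P2_def integrable_distr_eq intro!: prob_space_distr)
  show "ennreal (\<integral>y. y\<^sup>2 \<partial>distr M borel f) \<le> 2 * (\<integral>\<^sup>+x. ennreal ((x - f x)\<^sup>2) \<partial>M) + 2 * ennreal (\<integral>x. x\<^sup>2 \<partial>M)"
    using bound int by (simp add: integral_distr nn_integral_eq_integral)
qed

context transport_source
begin

lemma W2_sq_le_transport_objective:
  assumes "transport_objective k P Q \<le> v" "k > 0"
  shows "W2_sq P Q \<le> ennreal (1 / k\<^sup>2) * v"
proof -
  have "W2_sq P Q = ennreal (1 / k\<^sup>2) * (ennreal (k\<^sup>2) * W2_sq P Q)"
    using assms(2) by (simp add: mult.assoc[symmetric] ennreal_mult[symmetric])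
  also have "\<dots> \<le> ennreal (1 / k\<^sup>2) * v"
    using assms(1) by (intro mult_left_mono order_trans[OF _ assms(1)]) (auto simp: transport_objective_def)
  finally show ?thesis .
qed

theorem transport_objective_attains_minimum:
  assumes k: "k > 0"
  shows "\<exists>Q\<in>P2. transport_objective k P Q = (INF R\<in>P2. transport_objective k P R)"
proof -
  define V where "V = (INF R\<in>P2. transport_objective k P R)"
  have V_le: "V \<le> transport_objective k P R" if "R \<in> P2" for R
    unfolding V_def using that by (rule INF_lower)
  show ?thesis
  proof (cases "V = \<infinity>")
    case True
    then show ?thesis
      using V_le[OF P_in_P2] P_in_P2 by (auto simp: V_def top_unique intro!: bexI[of _ P])
  next
    case False
    \<comment> \<open>Finiteness of \<open>V\<close> makes the slack strict, so each level above
      \<open>V\<close> is undercut by some law.\<close>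
    have "\<exists>Q\<in>P2. transport_objective k P Q < V + ennreal (1 / Suc n)" for n
    proof -
      have "V < V + ennreal (1 / Suc n)"
        using False by (simp add: ennreal_add_left_cancel_less[of V 0, simplified])
      then show ?thesis unfolding V_def by (simp add: INF_less_iff)
    qed
    then obtain Q where Q: "\<And>n. Q n \<in> P2" and
      Q_less: "\<And>n. transport_objective k P (Q n) < V + ennreal (1 / Suc n)"
      by metis
    note QD = P2_real_distribution[OF Q]
    define f where "f n = monotone_rearrangement P (Q n)" for n
    have f_meas: "f n \<in> borel_measurable borel" for n
      unfolding f_def by (rule measurable_monotone_rearrangement[OF QD])
    have f_distr: "distr P borel (f n) = Q n" for n
      unfolding f_def by (rule distr_monotone_rearrangement[OF QD])
    \<comment> \<open>The second moment bound of \<open>distr_in_P2\<close> with transport cost at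
      most \<open>(V + 1) / k\<^sup>2\<close>, valid since the slack \<open>1 / Suc n\<close> is at
      most 1.\<close>
    define C where "C = 2 * (ennreal (1 / k\<^sup>2) * (V + 1)) + 2 * ennreal (\<integral>x. x\<^sup>2 \<partial>P)"
    have C_fin: "C < \<infinity>"
      using False by (simp add: C_def ennreal_mult_less_top less_top)
    have W2_bound: "(\<integral>\<^sup>+x. ennreal ((x - f n x)\<^sup>2) \<partial>P) \<le> ennreal (1 / k\<^sup>2) * (V + 1)" for n
    proof -
      have "ennreal (1 / Suc n) \<le> 1" by simp
      then have "transport_objective k P (Q n) \<le> V + 1"
        using Q_less[of n] by (meson add_left_mono less_imp_le order_trans)
      then show ?thesis
        unfolding f_def W2_sq_monotone_rearrangement[OF Q, symmetric]
        by (rule W2_sq_le_transport_objective[OF _ k])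
    qed
    have "ennreal (\<integral>x. x\<^sup>2 \<partial>Q n) \<le> C" for n
    proof -
      have "(\<integral>\<^sup>+x. ennreal ((x - f n x)\<^sup>2) \<partial>P) < \<infinity>"
        using W2_bound[of n] False by (auto simp: ennreal_mult_less_top less_top intro: le_less_trans)
      then have "ennreal (\<integral>x. x\<^sup>2 \<partial>Q n) \<le> 2 * (\<integral>\<^sup>+x. ennreal ((x - f n x)\<^sup>2) \<partial>P) + 2 * ennreal (\<integral>x. x\<^sup>2 \<partial>P)"
        using distr_in_P2(2)[OF f_meas second_moment] by (simp add: f_distr)
      also have "\<dots> \<le> C"
        unfolding C_def by (intro add_mono mult_left_mono W2_bound) auto
      finally show ?thesis .
    qed
    then have "(\<integral>x. x\<^sup>2 \<partial>Q n) \<le> enn2real C" for n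
      using C_fin by (cases C) (auto simp: ennreal_le_iff2)
    then have "tight Q"
      using Q by (intro second_moment_bound_imp_tight)
    then obtain r L where r: "strict_mono (r :: nat \<Rightarrow> nat)" and L: "real_distribution L"
      and conv: "weak_conv_m (\<lambda>n. Q (r n)) L"
      using tight_imp_convergent_subsubsequence[of Q id] by (auto simp: strict_mono_def comp_def)
    define h where "h = monotone_rearrangement P L"
    have h_meas: "h \<in> borel_measurable borel"
      unfolding h_def by (rule measurable_monotone_rearrangement[OF L])
    have "AE x in P. (\<lambda>n. f (r n) x) \<longlonglongrightarrow> h x"
      unfolding f_def h_def by (intro weak_conv_m_imp_AE_monotone_rearrangement_tendsto QD L conv)
    then have "map_objective k P h \<le> liminf (\<lambda>n. map_objective k P (f (r n)))"
      by (intro map_objective_lsc f_meas h_meas)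
    also have "\<dots> = liminf (\<lambda>n. transport_objective k P (Q (r n)))"
      unfolding f_def by (simp add: transport_objective_eq_map_objective Q)
    also have "\<dots> \<le> liminf (\<lambda>n. V + ennreal (1 / Suc (r n)))"
      by (intro Liminf_mono always_eventually allI less_imp_le Q_less)
    also have "\<dots> = V"
    proof (rule lim_imp_Liminf)
      have "(\<lambda>n. 1 / real (Suc (r n))) \<longlonglongrightarrow> 0"
        using LIMSEQ_subseq_LIMSEQ[OF LIMSEQ_Suc[OF lim_inverse_n'] r] by (simp add: comp_def)
      then have "(\<lambda>n. V + ennreal (1 / real (Suc (r n)))) \<longlonglongrightarrow> V + ennreal 0"
        by (intro tendsto_intros)
      then show "(\<lambda>n. V + ennreal (1 / real (Suc (r n)))) \<longlonglongrightarrow> V" by simp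
    qed simp
    finally have le: "map_objective k P h \<le> V" .
    \<comment> \<open>So far the weak limit \<open>L\<close> is only a probability law on the line.
      The finite value of \<open>map_objective\<close>, meaningful before second moments are known,
      bounds the cost of \<open>h\<close> and so places \<open>L\<close> in
      \<open>P2\<close>.\<close>
    have "ennreal (k\<^sup>2) * (\<integral>\<^sup>+x. ennreal ((x - h x)\<^sup>2) \<partial>P) \<le> map_objective k P h"
      unfolding map_objective_eq[OF h_meas] by simp
    also note le
    also have "V < \<infinity>" using False by (simp add: less_top)
    finally have "(\<integral>\<^sup>+x. ennreal ((x - h x)\<^sup>2) \<partial>P) < \<infinity>"
      using k by (auto simp: ennreal_mult_less_top)
    then have "L \<in> P2"
      using distr_in_P2(1)[OF h_meas second_moment] by (simp add: h_def distr_monotone_rearrangement[OF L])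
    moreover have "transport_objective k P L = V"
      using le V_le[OF \<open>L \<in> P2\<close>] by (simp add: transport_objective_eq_map_objective[OF \<open>L \<in> P2\<close>] h_def)
    ultimately show ?thesis by (auto simp: V_def)
  qed
qed

end

section \<open>Witsenhausen's problem\<close>

text \<open>The density is positive everywhere, so a Gaussian null set would be Lebesgue null, yet
  \<open>A\<close> contains an interval.\<close>

lemma measure_gaussian_pos:
  assumes "0 < \<sigma>" "A \<in> sets borel" "{a..b} \<subseteq> A" "a < b"
  shows "0 < measure (gaussian \<mu> \<sigma>) A"
proof -
  interpret real_distribution "gaussian \<mu> \<sigma>" by (rule real_distribution_gaussian) fact
  have "A \<notin> null_sets (gaussian \<mu> \<sigma>)"
  proof
    assume "A \<in> null_sets (gaussian \<mu> \<sigma>)"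
    then have "AE x in lborel. x \<in> A \<longrightarrow> ennreal (normal_density \<mu> \<sigma> x) = 0"
      unfolding gaussian_def by (subst (asm) null_sets_density_iff) auto
    then have "AE x in lborel. x \<notin> A"
      by eventually_elim (use normal_density_pos[OF assms(1), of \<mu>] in \<open>auto simp: less_le\<close>)
    then have "emeasure lborel A = 0"
      using assms(2) by (subst (asm) AE_iff_measurable[of A]) auto
    moreover have "emeasure lborel {a..b} \<le> emeasure lborel A"
      using assms(2,3) by (intro emeasure_mono) auto
    ultimately show False using assms(4) by simp
  qed
  then show ?thesis
    using assms(2) by (simp add: null_sets_def emeasure_eq_measure zero_less_measure_iff)
qed

lemma transport_source_gaussian:
  assumes \<sigma>: "0 < \<sigma>"
  shows "transport_source (gaussian \<mu> \<sigma>)"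
proof -
  let ?P = "gaussian \<mu> \<sigma>"
  interpret real_distribution ?P by (rule real_distribution_gaussian) fact
  show ?thesis
  proof
    fix x
    have "AE y in lborel. y \<in> {x} \<longrightarrow> ennreal (normal_density \<mu> \<sigma> y) = 0"
      using AE_lborel_singleton[of x] by eventually_elim simp
    then have "{x} \<in> null_sets ?P"
      unfolding gaussian_def by (simp add: null_sets_density_iff)
    then show "measure ?P {x} = 0" by (simp add: measure_eq_0_null_sets)
    show "0 < cdf ?P x"
      unfolding cdf_def by (rule measure_gaussian_pos[OF \<sigma>, of _ "x - 1" x]) auto
    have "0 < measure ?P {x<..}"
      by (rule measure_gaussian_pos[OF \<sigma>, of _ "x + 1" "x + 2"]) auto
    moreover have "measure ?P (space ?P - {..x}) = 1 - cdf ?P x"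
      unfolding cdf_def by (rule prob_compl) simp
    moreover have "space ?P - {..x} = {x<..}" by auto
    ultimately show "cdf ?P x < 1" by simp
    \<comment> \<open>Expands \<open>x\<^sup>2\<close> about \<open>\<mu>\<close>, reducing
      integrability to the central second moment, the first moment and the density itself.\<close>
    have "integrable lborel (\<lambda>x. normal_density \<mu> \<sigma> x * (x - \<mu>)\<^sup>2 + 2 * \<mu> * (normal_density \<mu> \<sigma> x * x) - \<mu>\<^sup>2 * normal_density \<mu> \<sigma> x)"
      using \<sigma> by (intro Bochner_Integration.integrable_add Bochner_Integration.integrable_diff
          integrable_mult_right integrable_normal_moment integrable_normal_moment_nz_1 integrable_normal_density)
    also have "(\<lambda>x. normal_density \<mu> \<sigma> x * (x - \<mu>)\<^sup>2 + 2 * \<mu> * (normal_density \<mu> \<sigma> x * x) - \<mu>\<^sup>2 * normal_density \<mu> \<sigma> x)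
        = (\<lambda>x. normal_density \<mu> \<sigma> x * x\<^sup>2)"
      by (simp add: power2_eq_square algebra_simps)
    finally show "integrable ?P (\<lambda>x. x\<^sup>2)"
      unfolding gaussian_def by (subst integrable_density) auto
  qed
qed

text \<open>Passes from the underlying probability space to laws: \<open>Y\<close> is a function of
  \<open>X0\<close>, hence independent of \<open>N\<close>. The control term is written as the
  transport cost of the map \<open>x + \<gamma>\<^sub>1 x\<close>.\<close>

lemma witsenhausen_cost_eq:
  assumes "prob_space M"
    and X0: "X0 \<in> borel_measurable M" "distr M borel X0 = P"
    and N: "N \<in> borel_measurable M" "distr M borel N = gaussian 0 1"
    and indep: "prob_space.indep_var M borel X0 borel N"
    and \<gamma>[measurable]: "\<gamma>\<^sub>1 \<in> borel_measurable borel" "\<gamma>\<^sub>2 \<in> borel_measurable borel"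
  shows "witsenhausen_cost M X0 N k \<gamma>\<^sub>1 \<gamma>\<^sub>2 =
    ennreal (k\<^sup>2) * (\<integral>\<^sup>+x. ennreal ((x - (x + \<gamma>\<^sub>1 x))\<^sup>2) \<partial>P) +
    (\<integral>\<^sup>+\<omega>. ennreal ((fst \<omega> - \<gamma>\<^sub>2 (fst \<omega> + snd \<omega>))\<^sup>2) \<partial>(distr P borel (\<lambda>x. x + \<gamma>\<^sub>1 x) \<Otimes>\<^sub>M gaussian 0 1))"
proof -
  interpret prob_space M by fact
  note [measurable] = X0(1) N(1)
  let ?Y = "\<lambda>\<omega>. X0 \<omega> + \<gamma>\<^sub>1 (X0 \<omega>)"
  have "indep_var borel ((\<lambda>x. x + \<gamma>\<^sub>1 x) \<circ> X0) borel ((\<lambda>x. x) \<circ> N)"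
    by (rule indep_var_compose[OF indep]) auto
  then have "distr M borel ?Y \<Otimes>\<^sub>M gaussian 0 1 = distr M (borel \<Otimes>\<^sub>M borel) (\<lambda>\<omega>. (?Y \<omega>, N \<omega>))"
    by (simp add: indep_var_distribution_eq comp_def N(2))
  moreover have "distr P borel (\<lambda>x. x + \<gamma>\<^sub>1 x) = distr M borel ?Y"
    unfolding X0(2)[symmetric] by (subst distr_distr) (auto simp: comp_def)
  ultimately have "(\<integral>\<^sup>+\<omega>. ennreal ((fst \<omega> - \<gamma>\<^sub>2 (fst \<omega> + snd \<omega>))\<^sup>2) \<partial>(distr P borel (\<lambda>x. x + \<gamma>\<^sub>1 x) \<Otimes>\<^sub>M gaussian 0 1))
      = (\<integral>\<^sup>+\<omega>. ennreal ((?Y \<omega> - \<gamma>\<^sub>2 (?Y \<omega> + N \<omega>))\<^sup>2) \<partial>M)"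
    by (simp add: nn_integral_distr)
  moreover have "(\<integral>\<^sup>+x. ennreal ((x - (x + \<gamma>\<^sub>1 x))\<^sup>2) \<partial>P) = (\<integral>\<^sup>+\<omega>. ennreal ((\<gamma>\<^sub>1 (X0 \<omega>))\<^sup>2) \<partial>M)"
    unfolding X0(2)[symmetric] by (simp add: nn_integral_distr)
  ultimately show ?thesis
    by (simp add: witsenhausen_cost_def Let_def)
qed

theorem theorem1p7:
  fixes \<sigma> k :: real and M :: "'a measure" and X0 N :: "'a \<Rightarrow> real" and P :: "real measure"
  assumes "\<sigma> > 0" and "k > 0"
    and "prob_space M"
    and "P = gaussian 0 \<sigma>"
    and "X0 \<in> borel_measurable M" and "distr M borel X0 = P"
    and "N \<in> borel_measurable M" and "distr M borel N = gaussian 0 1"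
    and "prob_space.indep_var M borel X0 borel N"
  shows "witsenhausen_value M X0 N k = (INF Q\<in>P2. transport_objective k P Q)
    \<and> (\<exists>Q\<in>P2. transport_objective k P Q = (INF R\<in>P2. transport_objective k P R))
    \<and> (\<forall>Q\<in>P2. transport_objective k P Q = (INF R\<in>P2. transport_objective k P R) \<longrightarrow>
         (let f = monotone_rearrangement P Q; \<gamma>\<^sub>1 = (\<lambda>x. f x - x) in
            \<gamma>\<^sub>1 \<in> borel_measurable borel
            \<and> distr M borel (\<lambda>\<omega>. X0 \<omega> + \<gamma>\<^sub>1 (X0 \<omega>)) = Q
            \<and> (\<exists>\<gamma>\<^sub>2\<in>borel_measurable borel.
                 witsenhausen_cost M X0 N k \<gamma>\<^sub>1 \<gamma>\<^sub>2 = witsenhausen_value M X0 N k)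
            \<and> optimal_transport_map P Q f
            \<and> (\<forall>T. optimal_transport_map P Q T \<longrightarrow> (AE x in P. T x = f x))))"
proof -
  interpret transport_source P
    unfolding assms(4) by (rule transport_source_gaussian[OF assms(1)])
  note cost = witsenhausen_cost_eq[OF assms(3,5,6,7,8,9)]
  let ?V = "INF Q\<in>P2. transport_objective k P Q"
  let ?J = "witsenhausen_cost M X0 N k"
  \<comment> \<open>The rearrangement and the posterior mean attain the transport term and the
    estimation term simultaneously.\<close>
  have realize: "?J (\<lambda>x. monotone_rearrangement P Q x - x) (posterior_mean Q) = transport_objective k P Q"
    if Q: "Q \<in> P2" for Q
  proof -
    interpret Q: P2_law Q by (rule P2_law[OF Q])
    note QD = P2_real_distribution[OF Q]
    note [measurable] = measurable_monotone_rearrangement[OF QD]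
    show ?thesis
      by (subst cost) (auto simp: transport_objective_def W2_sq_monotone_rearrangement[OF Q]
          distr_monotone_rearrangement[OF QD] Q.mmse_eq_posterior_error)
  qed
  \<comment> \<open>With finite control cost the law of \<open>Y\<close> lies in \<open>P2\<close>;
    its graph coupling bounds \<open>W2_sq\<close> and optimality of the posterior mean bounds
    \<open>mmse\<close>. Otherwise \<open>k > 0\<close> makes the total cost infinite.\<close>
  have lower: "?V \<le> ?J \<gamma>\<^sub>1 \<gamma>\<^sub>2"
    if [measurable]: "\<gamma>\<^sub>1 \<in> borel_measurable borel" "\<gamma>\<^sub>2 \<in> borel_measurable borel" for \<gamma>\<^sub>1 \<gamma>\<^sub>2
  proof (cases "(\<integral>\<^sup>+x. ennreal ((x - (x + \<gamma>\<^sub>1 x))\<^sup>2) \<partial>P) < \<infinity>")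
    case True
    define Q where "Q = distr P borel (\<lambda>x. x + \<gamma>\<^sub>1 x)"
    have Q: "Q \<in> P2"
      unfolding Q_def using True by (intro distr_in_P2(1) second_moment) auto
    then interpret Q: P2_law Q by (rule P2_law)
    have "(\<lambda>x. x + \<gamma>\<^sub>1 x) \<in> borel_measurable borel" by measurable
    note mc = map_coupling[OF real_distribution_axioms this]
    have "?V \<le> transport_objective k P Q"
      using Q by (rule INF_lower)
    also have "\<dots> \<le> ?J \<gamma>\<^sub>1 \<gamma>\<^sub>2"
      unfolding cost[OF that] transport_objective_def
    proof (intro add_mono mult_left_mono)
      show "W2_sq P Q \<le> (\<integral>\<^sup>+x. ennreal ((x - (x + \<gamma>\<^sub>1 x))\<^sup>2) \<partial>P)"
        unfolding W2_sq_def Q_def mc(2)[symmetric] by (rule INF_lower[OF mc(1)])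
      show "ennreal (mmse Q) \<le> (\<integral>\<^sup>+\<omega>. ennreal ((fst \<omega> - \<gamma>\<^sub>2 (fst \<omega> + snd \<omega>))\<^sup>2)
          \<partial>(distr P borel (\<lambda>x. x + \<gamma>\<^sub>1 x) \<Otimes>\<^sub>M gaussian 0 1))"
        unfolding Q.mmse_eq_posterior_error using Q.estimation_error_ge[OF that(2)] by (simp add: Q_def)
    qed simp
    finally show ?thesis .
  next
    case False
    then have "?J \<gamma>\<^sub>1 \<gamma>\<^sub>2 = \<infinity>"
      using assms(2) unfolding cost[OF that] by (simp add: less_top[symmetric] ennreal_mult_top)
    then show ?thesis by simp
  qed
  have ctrl_meas: "(\<lambda>x. monotone_rearrangement P Q x - x) \<in> borel_measurable borel"
    "posterior_mean Q \<in> borel_measurable borel" if "Q \<in> P2" for Q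
  proof -
    interpret Q: P2_law Q by (rule P2_law[OF that])
    note [measurable] = measurable_monotone_rearrangement[OF P2_real_distribution[OF that]]
    show "(\<lambda>x. monotone_rearrangement P Q x - x) \<in> borel_measurable borel"
      "posterior_mean Q \<in> borel_measurable borel" by measurable
  qed
  have upper: "witsenhausen_value M X0 N k \<le> transport_objective k P Q" if Q: "Q \<in> P2" for Q
    unfolding witsenhausen_value_def realize[OF Q, symmetric]
    using ctrl_meas[OF Q]
    by (intro INF_lower2[of "(\<lambda>x. monotone_rearrangement P Q x - x, posterior_mean Q)"]) auto
  have value_eq: "witsenhausen_value M X0 N k = ?V"
  proof (rule antisym)
    show "witsenhausen_value M X0 N k \<le> ?V"
      by (intro INF_greatest upper)
    show "?V \<le> witsenhausen_value M X0 N k"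
      unfolding witsenhausen_value_def using lower by (intro INF_greatest) auto
  qed
  have "\<exists>Q\<in>P2. transport_objective k P Q = ?V"
    by (rule transport_objective_attains_minimum[OF assms(2)])
  moreover have "let f = monotone_rearrangement P Q; \<gamma>\<^sub>1 = (\<lambda>x. f x - x) in
            \<gamma>\<^sub>1 \<in> borel_measurable borel
            \<and> distr M borel (\<lambda>\<omega>. X0 \<omega> + \<gamma>\<^sub>1 (X0 \<omega>)) = Q
            \<and> (\<exists>\<gamma>\<^sub>2\<in>borel_measurable borel. ?J \<gamma>\<^sub>1 \<gamma>\<^sub>2 = witsenhausen_value M X0 N k)
            \<and> optimal_transport_map P Q f
            \<and> (\<forall>T. optimal_transport_map P Q T \<longrightarrow> (AE x in P. T x = f x))"
    if Q: "Q \<in> P2" and min: "transport_objective k P Q = ?V" for Q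
  proof -
    note QD = P2_real_distribution[OF Q]
    note [measurable] = measurable_monotone_rearrangement[OF QD] assms(5)
    have "distr M borel (\<lambda>\<omega>. X0 \<omega> + (monotone_rearrangement P Q (X0 \<omega>) - X0 \<omega>))
        = distr (distr M borel X0) borel (monotone_rearrangement P Q)"
      by (subst distr_distr) (auto simp: comp_def)
    also have "\<dots> = Q"
      by (simp add: assms(6) distr_monotone_rearrangement[OF QD])
    finally show ?thesis
      using ctrl_meas[OF Q] realize[OF Q] min value_eq optimal_transport_map_unique[OF Q]
        optimal_transport_map_monotone_rearrangement[OF Q]
      unfolding Let_def by (intro conjI allI impI bexI[of _ "posterior_mean Q"]) auto
  qed
  ultimately show ?thesis using value_eq by blast
qed

end
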